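(* Let $d\ge1$ and let $K_i(s,t)=\Phi_i(s-t)$, $i=1,\dots,d$, be positive-definite kernels on $\mathbb{R}$ such that each $\Phi_i\colon\mathbb{R}\to\mathbb{R}$ is continuous and integrable and there are constants $C_{1,i},C_{2,i}>0$ and $\alpha_i>1/2$ with $C_{1,i}(1+\xi^2)^{-\alpha_i}\le\widehat{\Phi_i}(\xi)\le C_{2,i}(1+\xi^2)^{-\alpha_i}$ for all $\xi\in\mathbb{R}$. For $\theta=\{\lambda_1,\dots,\lambda_d\}$ with $\lambda_i>0$ consider the product kernel on $\mathbb{R}^d$ $$K_\theta(x,y)=\prod_{i=1}^d\Phi_i\Big(\frac{x_i-y_i}{\lambda_i}\Big),\qquad x=(x_1,\dots,x_d),\ y=(y_1,\dots,y_d)\in\mathbb{R}^d.$$ Let $X=X_1\times\cdots\times X_d$, where $X_i=\{x_{i,1},\dots,x_{i,n_i}\}\subset\mathbb{R}$ consists of $n_i\ge1$ distinct points for each $i=1,\dots,d$, let $m\colon\mathbb{R}^d\to\mathbb{R}$ be a function, and let $Y$ be a data vector with entries $y_{i_1,\dots,i_d}\in\mathbb{R}$ associated with the points $(x_{1,i_1},\dots,x_{d,i_d})\in X$. Let $Y_m=Y-m(X)$ and $$\ell(\lambda_1,\dots,\lambda_d\mid Y)=Y_m^{\mathsf T}K_\theta(X,X)^{-1}Y_m+\log\det K_\theta(X,X).$$ Let $p\in\{1,\dots,d\}$, fix $\lambda_i>0$ for $i\ne p$, and let $\lambda_{p,\mathrm{ML}}=\arg\min_{\lambda_p>0}\ell(\lambda_1,\dots,\lambda_d\mid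 Y)$ be the maximum likelihood estimate of the $p$th lengthscale parameter. If $Y$ is $m$-constant along dimension $p$, i.e. $y_{i_1,\dots,i_d}-m(x_{1,i_1},\dots,x_{d,i_d})$ does not depend on $i_p\in\{1,\dots,n_p\}$, then $$\lim_{\lambda_p\to\infty}\ell(\lambda_1,\dots,\lambda_d\mid Y)=-\infty\quad\text{and}\quad\lambda_{p,\mathrm{ML}}=\infty.$$
   Context: A kernel is a symmetric function; it is (strictly) positive-definite if $\sum_{i,j}a_ia_jK(z_i,z_j)>0$ for all $N\in\mathbb{N}$, all non-zero $a\in\mathbb{R}^N$ and all distinct $z_1,\dots,z_N$. The Fourier transform on $\mathbb{R}$ is $\widehat f(\xi)=\int_{\mathbb{R}}f(x)e^{-\mathrm{i}\xi x}\,dx$. $K_\theta(X,X)$ is the matrix of values $K_\theta(x,x')$, $x,x'\in X$, and $m(X)$ the vector of values $m(x)$, $x\in X$, both indexed in the same order as $Y$. The statement $\lambda_{p,\mathrm{ML}}=\infty$ means that the infimum of $\ell$ over $\lambda_p>0$ (the other lengthscales being fixed) is approached only as $\lambda_p\to\infty$.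
   Formalization: The formal theorem additionally assumes n_p ≥ 2; for n_p = 1 the objective ℓ does not depend on λ_p at all, so it is constant in λ_p and the claim fails. *)

theory Defs
  imports "HOL-Analysis.Analysis"
begin

definition positive_definite_kernel :: "('a \<Rightarrow> 'a \<Rightarrow> real) \<Rightarrow> bool" where
  "positive_definite_kernel K \<longleftrightarrow>
     (\<forall>s t. K s t = K t s) \<and>
     (\<forall>(N::nat) (a :: nat \<Rightarrow> real) (z :: nat \<Rightarrow> 'a).
        (\<exists>i<N. a i \<noteq> 0) \<longrightarrow> inj_on z {..<N} \<longrightarrow>
        (\<Sum>i<N. \<Sum>j<N. a i * a j * K (z i) (z j)) > 0)"

definition fourier_transform :: "(real \<Rightarrow> real) \<Rightarrow> real \<Rightarrow> complex" where
  "fourier_transform f \<xi> =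
     (LINT x|lborel. complex_of_real (f x) * exp (- (\<i> * complex_of_real (\<xi> * x))))"

text \<open>The Fourier transform is complex-valued, so the two-sided bound includes that its values
  are real.\<close>

definition fourier_decay :: "(real \<Rightarrow> real) \<Rightarrow> bool" where
  "fourier_decay \<Phi> \<longleftrightarrow>
     (\<exists>C1 C2 \<alpha> :: real. 0 < C1 \<and> 0 < C2 \<and> 1 / 2 < \<alpha> \<and>
        (\<forall>\<xi>. fourier_transform \<Phi> \<xi> \<in> \<real> \<and>
             C1 * (1 + \<xi>\<^sup>2) powr (- \<alpha>) \<le> Re (fourier_transform \<Phi> \<xi>) \<and>
             Re (fourier_transform \<Phi> \<xi>) \<le> C2 * (1 + \<xi>\<^sup>2) powr (- \<alpha>)))"

definition product_kernel ::
    "('d::finite \<Rightarrow> real \<Rightarrow> real) \<Rightarrow> ('d \<Rightarrow> real) \<Rightarrow> real ^ 'd \<Rightarrow> real ^ 'd \<Rightarrow> real" where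
  "product_kernel \<Phi> lam x y = (\<Prod>i\<in>UNIV. \<Phi> i ((x $ i - y $ i) / lam i))"

text \<open>The points of dimension \<open>i\<close> are \<open>x i 1, \<dots>, x i (n i)\<close>; a multi-index \<open>j\<close> selects the point
  with \<open>i\<close>-th coordinate \<open>x i (j i)\<close> of the product grid.  If \<open>n p = 1\<close>, all grid points agree in coordinate \<open>p\<close>, so the kernel matrix of the
  product kernel does not depend on \<open>lam p\<close>; statements about \<open>lam p\<close> tending to infinity therefore
  need \<open>2 \<le> n p\<close>.\<close>

definition multi_indices :: "('d::finite \<Rightarrow> nat) \<Rightarrow> ('d \<Rightarrow> nat) set" where
  "multi_indices n = {j. \<forall>i. j i \<in> {1..n i}}"

definition grid_point :: "('d::finite \<Rightarrow> nat \<Rightarrow> real) \<Rightarrow> ('d \<Rightarrow> nat) \<Rightarrow> real ^ 'd" where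
  "grid_point x j = (\<chi> i. x i (j i))"

definition m_constant_along ::
    "'d::finite \<Rightarrow> ('d \<Rightarrow> nat) \<Rightarrow> ('d \<Rightarrow> nat \<Rightarrow> real) \<Rightarrow> (real ^ 'd \<Rightarrow> real) \<Rightarrow>
     (('d \<Rightarrow> nat) \<Rightarrow> real) \<Rightarrow> bool" where
  "m_constant_along p n x m y \<longleftrightarrow>
     (\<forall>j\<in>multi_indices n. \<forall>j'\<in>multi_indices n. (\<forall>i. i \<noteq> p \<longrightarrow> j i = j' i) \<longrightarrow>
        y j - m (grid_point x j) = y j' - m (grid_point x j'))"

text \<open>The finite type \<open>'n\<close> labels the data points in an arbitrary order; \<open>pts k\<close> is the point
  with label \<open>k\<close> and \<open>Y $ k\<close> the datum observed there.\<close>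

definition kernel_matrix :: "('a \<Rightarrow> 'a \<Rightarrow> real) \<Rightarrow> ('n::finite \<Rightarrow> 'a) \<Rightarrow> real ^ 'n ^ 'n" where
  "kernel_matrix K pts = (\<chi> k l. K (pts k) (pts l))"

definition likelihood_objective ::
    "('a \<Rightarrow> 'a \<Rightarrow> real) \<Rightarrow> ('a \<Rightarrow> real) \<Rightarrow> ('n::finite \<Rightarrow> 'a) \<Rightarrow> real ^ 'n \<Rightarrow> real" where
  "likelihood_objective K m pts Y =
     (let Ym = Y - (\<chi> k. m (pts k)); M = kernel_matrix K pts
      in Ym \<bullet> (matrix_inv M *v Ym) + ln (det M))"

text \<open>The statement that the minimiser over \<open>(0, \<infinity>)\<close> is \<open>\<infinity>\<close>: the infimum, taken in the extended
  reals, is approached only at infinity, i.e. every minimising sequence diverges to \<open>\<infinity>\<close>.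
  Minimising sequences always exist; constant ones show that the infimum is not attained.\<close>

definition argmin_is_infinity :: "(real \<Rightarrow> real) \<Rightarrow> bool" where
  "argmin_is_infinity f \<longleftrightarrow>
     (\<forall>s :: nat \<Rightarrow> real. (\<forall>k. 0 < s k) \<longrightarrow>
        (\<lambda>k. ereal (f (s k))) \<longlonglongrightarrow> (INF t\<in>{0<..}. ereal (f t)) \<longrightarrow>
        filterlim s at_top sequentially)"

end

theory Submission
  imports Defs "HOL-Probability.Characteristic_Functions"
begin

text \<open>
  Write \<open>M t\<close> for the kernel matrix and \<open>w\<close> for the residual vector \<open>Y - m(X)\<close>, so that
  \<open>L t = w \<bullet> (M t)\<inverse> w + ln (det (M t))\<close>.  Since the kernel is a product and the points form a grid,
  \<open>M t\<close> is an entrywise product of one factor per dimension, and only the factor of dimension \<open>p\<close>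
  depends on \<open>t\<close>.  As \<open>t \<rightarrow> \<infinity>\<close> that factor tends to the constant \<open>\<Phi> p 0\<close>; two grid points that differ
  in coordinate \<open>p\<close> only then give equal rows, so \<open>det (M t) \<rightarrow> 0\<close> and the logarithm tends to \<open>-\<infinity>\<close>.
  The point is that the quadratic term stays bounded although \<open>M t\<close> becomes singular.

  By duality the quadratic term is at most \<open>C\<close> as soon as \<open>(b \<bullet> w)\<^sup>2 \<le> C * (b \<bullet> M t b)\<close> for all \<open>b\<close>
  (\<open>inverse_form_le\<close>).  For one-dimensional points \<open>z u\<close> there is a constant \<open>c > 0\<close>, depending on
  \<open>\<Phi>\<close> and on the number of points but not on their position, with
  \<open>c * (\<Sum>u. a u)\<^sup>2 \<le> (\<Sum>u v. a u * a v * \<Phi> (z u - z v))\<close> (\<open>translation_kernel_dominates_constant\<close>).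
  So the \<open>p\<close>-th factor minus the constant kernel \<open>c\<close> is positive semidefinite for every \<open>t\<close>, while the
  other factors dominate positive multiples of the identity kernel.  The Schur product theorem
  multiplies these comparisons, and \<open>M t\<close> dominates, uniformly in \<open>t\<close>, a multiple of the matrix that
  sums \<open>b\<close> over the lines parallel to axis \<open>p\<close>.  As \<open>w\<close> is constant on these lines, Cauchy--Schwarz
  finishes the bound.

  The uniform constant \<open>c\<close> comes from two facts.  By Fourier inversion the quadratic form of \<open>\<Phi>\<close> at \<open>a\<close>
  is the integral of \<open>\<bar>\<Sum>u. a u * exp (i \<xi> z u)\<bar>\<^sup>2\<close> against the Fourier transform of \<open>\<Phi>\<close>, which is nonnegative
  and bounded below on \<open>[0,1]\<close>.  And by an inequality of Turan type, an exponential sum with \<open>n\<close> terms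
  satisfies \<open>\<bar>A 0\<bar>\<^sup>2 \<le> 4 ^ n * n ^ 3 * (\<integral>\<xi>\<in>[0,1]. \<bar>A \<xi>\<bar>\<^sup>2)\<close> whatever its frequencies are
  (\<open>expsum_turan_mean_square\<close>).

  For the minimiser, \<open>L\<close> must be bounded below on \<open>(0, T]\<close>.  As \<open>L t \<ge> ln (det (M t))\<close>, it is enough that
  the determinant is continuous, positive, and has a positive limit at \<open>0\<close>.  The limit exists and is
  positive because \<open>\<Phi> p\<close> vanishes at infinity, so that the \<open>p\<close>-th factor tends to \<open>\<Phi> p 0\<close> times the
  identity kernel.
\<close>

section \<open>Positive semidefinite kernels on finite sets\<close>

definition qform :: "'a set \<Rightarrow> ('a \<Rightarrow> 'a \<Rightarrow> real) \<Rightarrow> ('a \<Rightarrow> real) \<Rightarrow> real" where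
  "qform I A b = (\<Sum>u\<in>I. \<Sum>v\<in>I. b u * b v * A u v)"

definition psd_on :: "'a set \<Rightarrow> ('a \<Rightarrow> 'a \<Rightarrow> real) \<Rightarrow> bool" where
  "psd_on I A \<longleftrightarrow> (\<forall>u\<in>I. \<forall>v\<in>I. A u v = A v u) \<and> (\<forall>b. 0 \<le> qform I A b)"

definition positive_on :: "'a set \<Rightarrow> ('a \<Rightarrow> 'a \<Rightarrow> real) \<Rightarrow> bool" where
  "positive_on I A \<longleftrightarrow> (\<forall>u\<in>I. \<forall>v\<in>I. A u v = A v u) \<and>
     (\<forall>b. (\<exists>u\<in>I. b u \<noteq> 0) \<longrightarrow> 0 < qform I A b)"

lemma qform_cong:
  assumes "\<And>u. u \<in> I \<Longrightarrow> b u = b' u" "\<And>u v. u \<in> I \<Longrightarrow> v \<in> I \<Longrightarrow> A u v = A' u v"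
  shows "qform I A b = qform I A' b'"
  unfolding qform_def using assms by (intro sum.cong) auto

lemma qform_insert:
  assumes "finite I" "a \<notin> I" "\<And>u. u \<in> I \<Longrightarrow> A u a = A a u"
  shows "qform (insert a I) A b
           = (b a)\<^sup>2 * A a a + 2 * b a * (\<Sum>u\<in>I. b u * A a u) + qform I A b"
proof -
  have "(\<Sum>u\<in>I. b u * b a * A u a) = b a * (\<Sum>u\<in>I. b u * A a u)"
    using assms(3) by (simp add: sum_distrib_left mult_ac)
  moreover have "(\<Sum>v\<in>I. b a * b v * A a v) = b a * (\<Sum>u\<in>I. b u * A a u)"
    by (simp add: sum_distrib_left mult_ac)
  ultimately show ?thesis
    using assms(1,2) by (simp add: qform_def sum.distrib power2_eq_square)
qed

lemma qform_rank_one: "qform I (\<lambda>u v. f u * f v) b = (\<Sum>u\<in>I. b u * f u)\<^sup>2"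
  by (simp add: qform_def power2_eq_square sum_product mult_ac)

lemma qform_const: "qform I (\<lambda>u v. c) b = c * (\<Sum>u\<in>I. b u)\<^sup>2"
  by (simp add: qform_def power2_eq_square sum_product sum_distrib_left mult_ac)

lemma qform_diff: "qform I (\<lambda>u v. A u v - B u v) b = qform I A b - qform I B b"
  by (simp add: qform_def sum_subtractf right_diff_distrib)

lemma qform_add: "qform I (\<lambda>u v. A u v + B u v) b = qform I A b + qform I B b"
  by (simp add: qform_def sum.distrib distrib_left)

lemma qform_cmult: "qform I (\<lambda>u v. c * A u v) b = c * qform I A b"
  by (simp add: qform_def sum_distrib_left mult_ac)

lemma qform_sum: "qform I (\<lambda>u v. \<Sum>r\<in>R. A r u v) b = (\<Sum>r\<in>R. qform I (A r) b)"
proof -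
  have "(\<Sum>u\<in>I. \<Sum>v\<in>I. \<Sum>r\<in>R. b u * b v * A r u v)
      = (\<Sum>u\<in>I. \<Sum>r\<in>R. \<Sum>v\<in>I. b u * b v * A r u v)"
    by (intro sum.cong refl sum.swap)
  also have "\<dots> = (\<Sum>r\<in>R. \<Sum>u\<in>I. \<Sum>v\<in>I. b u * b v * A r u v)"
    by (rule sum.swap)
  finally show ?thesis by (simp add: qform_def sum_distrib_left)
qed

lemma qform_indicator:
  assumes "finite I" "a \<in> I"
  shows "qform I A (\<lambda>v. if v = a then 1 else 0) = A a a"
proof -
  have "qform I A (\<lambda>v. if v = a then 1 else 0) = (\<Sum>u\<in>I. if u = a then A a a else 0)"
    unfolding qform_def
  proof (intro sum.cong refl)
    fix u
    have "(\<Sum>v\<in>I. (if u = a then 1 else 0) * (if v = a then 1 else 0) * A u v)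
        = (\<Sum>v\<in>I. if v = a then (if u = a then A a a else 0) else 0)"
      by (intro sum.cong) auto
    then show "(\<Sum>v\<in>I. (if u = a then 1 else 0) * (if v = a then 1 else 0) * A u v)
        = (if u = a then A a a else 0)"
      using assms by simp
  qed
  then show ?thesis using assms by simp
qed

lemma qform_diag:
  assumes "finite I"
  shows "qform I (\<lambda>u v. r * of_bool (u = v)) b = r * (\<Sum>u\<in>I. (b u)\<^sup>2)"
proof -
  have "(\<Sum>v\<in>I. b u * b v * (r * of_bool (u = v))) = r * (b u)\<^sup>2" if "u \<in> I" for u
  proof -
    have "(\<Sum>v\<in>I. b u * b v * (r * of_bool (u = v))) = (\<Sum>v\<in>I. if u = v then r * (b u)\<^sup>2 else 0)"
      by (intro sum.cong) (auto simp: power2_eq_square)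
    then show ?thesis using assms that by simp
  qed
  then show ?thesis by (simp add: qform_def sum_distrib_left)
qed

lemma qform_fun_upd: "a \<notin> I \<Longrightarrow> qform I A (b(a := t)) = qform I A b"
  by (rule qform_cong) auto

definition schur_complement :: "'a \<Rightarrow> ('a \<Rightarrow> 'a \<Rightarrow> real) \<Rightarrow> 'a \<Rightarrow> 'a \<Rightarrow> real" where
  "schur_complement a A u v = A u v - A a u * A a v / A a a"

lemma qform_schur_complement:
  "qform I (schur_complement a A) b = qform I A b - (\<Sum>u\<in>I. b u * A a u)\<^sup>2 / A a a"
proof -
  have "qform I (schur_complement a A) b
      = qform I (\<lambda>u v. A u v - inverse (A a a) * (A a u * A a v)) b"
    by (rule qform_cong) (auto simp: schur_complement_def field_simps)
  then show ?thesis
    by (simp add: qform_diff qform_cmult qform_rank_one divide_inverse mult.commute)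
qed

text \<open>  Completing the square in the variable \<open>b a\<close>: the Schur complement is the form that remains. This is
  one step of the Cholesky decomposition.\<close>

lemma qform_insert_complete_square:
  assumes "finite I" "a \<notin> I" "\<And>u. u \<in> I \<Longrightarrow> A u a = A a u" "A a a \<noteq> 0"
  shows "qform (insert a I) A b = A a a * (b a + (\<Sum>u\<in>I. b u * A a u) / A a a)\<^sup>2
           + qform I (schur_complement a A) b"
  using assms(4)
  by (simp add: qform_insert[of I a A, OF assms(1-3)] qform_schur_complement power2_eq_square field_simps)

text \<open>  The value of \<open>b a\<close> that makes the square vanish realises the Schur complement as a restriction of
  the original form; hence the Schur complement inherits positivity.\<close>

lemma qform_extend_schur_complement:
  assumes "finite I" "a \<notin> I" "\<And>u. u \<in> I \<Longrightarrow> A u a = A a u" "A a a \<noteq> 0"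
  shows "qform (insert a I) A (b(a := - (\<Sum>u\<in>I. b u * A a u) / A a a))
           = qform I (schur_complement a A) b"
proof -
  have "(\<Sum>u\<in>I. (b(a := s)) u * A a u) = (\<Sum>u\<in>I. b u * A a u)" for s
    using assms(2) by (intro sum.cong) auto
  then show ?thesis
    using qform_insert_complete_square[of I a A "b(a := - (\<Sum>u\<in>I. b u * A a u) / A a a)", OF assms]
    by (simp add: qform_fun_upd assms(2) del: fun_upd_apply) simp
qed

lemma psd_onI_gram:
  assumes "\<And>u v. u \<in> I \<Longrightarrow> v \<in> I \<Longrightarrow> A u v = (\<Sum>r\<in>R. f r u * f r v)"
  shows "psd_on I A"
proof -
  have "qform I A b = (\<Sum>r\<in>R. (\<Sum>u\<in>I. b u * f r u)\<^sup>2)" for b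
    using qform_cong[of I b b A "\<lambda>u v. \<Sum>r\<in>R. f r u * f r v", OF refl assms] by (simp add: qform_sum qform_rank_one)
  then show ?thesis
    using assms by (simp add: psd_on_def sum_nonneg mult.commute)
qed

text \<open>  Otherwise the form would be affine and non-constant in the variable \<open>b a\<close>. The Cholesky step needs
  this at a zero pivot, where \<open>x / 0 = 0\<close> makes the Schur complement equal to \<open>A\<close> itself.\<close>

lemma psd_on_diag_zero:
  assumes "psd_on (insert a I) A" "finite I" "A a a = 0" "u \<in> I"
  shows "A a u = 0"
proof (rule ccontr)
  assume ne: "A a u \<noteq> 0"
  then have ua: "u \<noteq> a" using assms(3) by auto
  have sym: "A u a = A a u" using assms(1,4) unfolding psd_on_def by blast
  \<comment> \<open>the weight at \<open>a\<close> makes the form equal to \<open>-1\<close>\<close>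
  define b where "b = (\<lambda>v. if v = a then - (A u u + 1) / (2 * A a u) else if v = u then 1 else 0::real)"
  have "qform (insert a I) A b = (\<Sum>v\<in>{a,u}. \<Sum>w\<in>{a,u}. b v * b w * A v w)"
    unfolding qform_def
  proof (rule sum.mono_neutral_cong_right)
    show "(\<Sum>w\<in>insert a I. b v * b w * A v w) = (\<Sum>w\<in>{a,u}. b v * b w * A v w)" for v
      using assms(2,4) by (intro sum.mono_neutral_cong_right) (auto simp: b_def)
  qed (use assms(2,4) in \<open>auto simp: b_def intro!: sum.neutral\<close>)
  also have "\<dots> = 2 * b a * A a u + A u u"
    using assms(3) ua sym by (simp add: b_def)
  also have "\<dots> = -1" using ne by (simp add: b_def field_simps)
  finally have "qform (insert a I) A b = -1" .
  moreover have "0 \<le> qform (insert a I) A b" using assms(1) unfolding psd_on_def by blast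
  ultimately show False by simp
qed

lemma psd_on_diag_nonneg:
  assumes "psd_on I A" "finite I" "a \<in> I"
  shows "0 \<le> A a a"
proof -
  show ?thesis using qform_indicator[OF assms(2,3)] assms(1) unfolding psd_on_def by metis
qed

lemma psd_on_schur_complement:
  assumes "psd_on (insert a I) A" "finite I" "a \<notin> I"
  shows "psd_on I (schur_complement a A)"
proof -
  have sym: "A u v = A v u" if "u \<in> insert a I" "v \<in> insert a I" for u v
    using assms(1) that by (auto simp: psd_on_def)
  have "0 \<le> qform I (schur_complement a A) b" for b
  proof (cases "A a a = 0")
    case True
    have "qform (insert a I) A (b(a := 0)) = qform I (schur_complement a A) b"
      using True assms sym by (simp add: qform_insert qform_schur_complement qform_fun_upd)
    then show ?thesis using assms(1) by (metis psd_on_def)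
  next
    case False
    show ?thesis
      using qform_extend_schur_complement[of I a A b, OF assms(2,3) _ False] sym assms(1)
      by (metis insertCI psd_on_def)
  qed
  then show ?thesis using sym by (auto simp: psd_on_def schur_complement_def)
qed

text \<open>  Cholesky decomposition, one pivot at a time. With a Gram representation at hand, the pullback and
  Schur product theorems below become identities between sums of squares.\<close>

lemma psd_on_imp_gram:
  assumes "finite I" "psd_on I A"
  shows "\<exists>f. \<forall>u\<in>I. \<forall>v\<in>I. A u v = (\<Sum>r\<in>I. f r u * f r v)"
  using assms
proof (induction I arbitrary: A rule: finite_induct)
  case (insert a I)
  obtain f where f: "\<And>u v. u \<in> I \<Longrightarrow> v \<in> I \<Longrightarrow> schur_complement a A u v = (\<Sum>r\<in>I. f r u * f r v)"
    using insert.IH[OF psd_on_schur_complement[OF insert.prems insert.hyps(1,2)]] by blast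
  \<comment> \<open>the pivot contributes its scaled row; the vectors of the Schur complement vanish at the pivot\<close>
  define g where "g = (\<lambda>r u. if r = a then A a u / sqrt (A a a) else if u = a then 0 else f r u)"
  have sym: "A u v = A v u" if "u \<in> insert a I" "v \<in> insert a I" for u v
    using insert.prems that by (auto simp: psd_on_def)
  have nn: "0 \<le> A a a" using psd_on_diag_nonneg[OF insert.prems] insert.hyps by simp
  have pivot: "A a u * A a v / A a a = g a u * g a v" for u v
    using nn by (simp add: g_def)
  have row: "A a u = A a a * A a u / A a a" if "u \<in> insert a I" for u
    using psd_on_diag_zero[OF insert.prems insert.hyps(1)] that by (cases "A a a = 0") auto
  have "A u v = g a u * g a v + (\<Sum>r\<in>I. g r u * g r v)"
    if uv: "u \<in> insert a I" "v \<in> insert a I" for u v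
  proof (cases "u = a \<or> v = a")
    case True
    then have "(\<Sum>r\<in>I. g r u * g r v) = 0"
      using insert.hyps by (intro sum.neutral) (auto simp: g_def)
    moreover have "A u v = A a u * A a v / A a a"
      using True row[OF uv(1)] row[OF uv(2)] sym[OF uv] by (auto simp: mult_ac)
    ultimately show ?thesis using pivot by simp
  next
    case False
    then have "(\<Sum>r\<in>I. g r u * g r v) = schur_complement a A u v"
      using uv insert.hyps by (subst f) (auto simp: g_def intro!: sum.cong)
    then show ?thesis using pivot[of u v] by (simp add: schur_complement_def)
  qed
  then show ?case using insert.hyps by (intro exI[of _ g]) auto
qed simp

lemma psd_on_pullback:
  assumes "finite I" "psd_on I A" "\<And>j. j \<in> J \<Longrightarrow> \<pi> j \<in> I"
  shows "psd_on J (\<lambda>j l. A (\<pi> j) (\<pi> l))"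
proof -
  obtain f where "\<And>u v. u \<in> I \<Longrightarrow> v \<in> I \<Longrightarrow> A u v = (\<Sum>r\<in>I. f r u * f r v)"
    using psd_on_imp_gram[OF assms(1,2)] by blast
  then show ?thesis
    using assms(3) by (intro psd_onI_gram[where R = I and f = "\<lambda>r j. f r (\<pi> j)"]) auto
qed

text \<open>  The Schur product theorem: the pairwise products of the vectors of two Gram representations form a
  Gram representation of the entrywise product.\<close>

lemma psd_on_mult:
  assumes "finite I" "psd_on I A" "psd_on I B"
  shows "psd_on I (\<lambda>u v. A u v * B u v)"
proof -
  obtain f g where f: "\<And>u v. u \<in> I \<Longrightarrow> v \<in> I \<Longrightarrow> A u v = (\<Sum>r\<in>I. f r u * f r v)"
    and g: "\<And>u v. u \<in> I \<Longrightarrow> v \<in> I \<Longrightarrow> B u v = (\<Sum>s\<in>I. g s u * g s v)"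
    using psd_on_imp_gram[OF assms(1,2)] psd_on_imp_gram[OF assms(1,3)] by metis
  show ?thesis
  proof (rule psd_onI_gram[where R = "I \<times> I" and f = "\<lambda>(r,s) u. f r u * g s u"])
    fix u v assume "u \<in> I" "v \<in> I"
    then show "A u v * B u v = (\<Sum>rs\<in>I\<times>I. (case rs of (r,s) \<Rightarrow> \<lambda>u. f r u * g s u) u
        * (case rs of (r,s) \<Rightarrow> \<lambda>u. f r u * g s u) v)"
      by (simp add: f g sum_product sum.cartesian_product split_def mult_ac)
  qed
qed

lemma psd_on_add: "psd_on I A \<Longrightarrow> psd_on I B \<Longrightarrow> psd_on I (\<lambda>u v. A u v + B u v)"
  by (auto simp: psd_on_def qform_add)

lemma psd_on_diag: "finite I \<Longrightarrow> 0 \<le> r \<Longrightarrow> psd_on I (\<lambda>u v. r * of_bool (u = v))"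
  by (auto simp: psd_on_def qform_diag sum_nonneg)

lemma psd_on_const: "0 \<le> c \<Longrightarrow> psd_on I (\<lambda>u v. c)"
  by (auto simp: psd_on_def qform_const)

text \<open>  In the order given by positive semidefiniteness, entrywise products of positive semidefinite
  kernels are monotone, because \<open>A P - A' P' = (A - A') P + A' (P - P')\<close>.\<close>

lemma psd_on_prod_mono:
  assumes "finite J" "finite S"
    and "\<And>i. i \<in> S \<Longrightarrow> psd_on J (A' i)"
    and "\<And>i. i \<in> S \<Longrightarrow> psd_on J (\<lambda>u v. A i u v - A' i u v)"
  shows "psd_on J (\<lambda>u v. \<Prod>i\<in>S. A' i u v) \<and>
         psd_on J (\<lambda>u v. (\<Prod>i\<in>S. A i u v) - (\<Prod>i\<in>S. A' i u v))"
  using assms(2-4)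
proof (induction S rule: finite_induct)
  case empty
  have "psd_on J (\<lambda>u v. 1)"
    by (rule psd_onI_gram[where R = "{()}" and f = "\<lambda>_ _. 1"]) simp
  then show ?case by (simp add: psd_on_def qform_def)
next
  case (insert i S)
  let ?P' = "\<lambda>u v. \<Prod>i\<in>S. A' i u v" and ?P = "\<lambda>u v. \<Prod>i\<in>S. A i u v"
  have IH: "psd_on J ?P'" "psd_on J (\<lambda>u v. ?P u v - ?P' u v)"
    using insert by auto
  have i: "psd_on J (A' i)" "psd_on J (\<lambda>u v. A i u v - A' i u v)"
    using insert.prems by auto
  have P: "psd_on J ?P" using psd_on_add[OF IH] by simp
  have "psd_on J (\<lambda>u v. (A i u v - A' i u v) * ?P u v + A' i u v * (?P u v - ?P' u v))"
    by (intro psd_on_add psd_on_mult assms(1) i IH P)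
  moreover have "(\<lambda>u v. (A i u v - A' i u v) * ?P u v + A' i u v * (?P u v - ?P' u v))
      = (\<lambda>u v. A i u v * ?P u v - A' i u v * ?P' u v)"
    by (simp add: algebra_simps)
  ultimately show ?case
    using insert.hyps psd_on_mult[OF assms(1) i(1) IH(1)] by simp
qed

text \<open>  A lower bound for the smallest eigenvalue. The induction removes one variable by completing the
  square; the square controls \<open>b a\<close> up to a linear combination of the other variables, which the
  Schur complement controls.\<close>

lemma strictly_positive_form_lower_bound:
  assumes "finite I" "\<And>u v. u \<in> I \<Longrightarrow> v \<in> I \<Longrightarrow> A u v = A v u"
    and "\<And>b. (\<exists>u\<in>I. b u \<noteq> 0) \<Longrightarrow> 0 < qform I A b"
  shows "\<exists>r>0. \<forall>b. r * (\<Sum>u\<in>I. (b u)\<^sup>2) \<le> qform I A b"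
  using assms
proof (induction I arbitrary: A rule: finite_induct)
  case empty
  then show ?case by (intro exI[of _ 1]) (simp add: qform_def)
next
  case (insert a I)
  have sym: "A u v = A v u" if "u \<in> insert a I" "v \<in> insert a I" for u v
    using insert.prems(1) that by blast
  have "qform (insert a I) A (\<lambda>v. if v = a then 1 else 0) = A a a"
    using insert.hyps by (simp add: qform_indicator)
  then have pos: "0 < A a a" 
    using insert.prems(2)[of "\<lambda>v. if v = a then 1 else 0"] by simp
  define S where "S = schur_complement a A"
  have S_sym: "S u v = S v u" if "u \<in> I" "v \<in> I" for u v
    using sym that by (simp add: S_def schur_complement_def)
  have S_pos: "0 < qform I S b" if ex: "\<exists>u\<in>I. b u \<noteq> 0" for b
  proof -
    let ?b = "b(a := - (\<Sum>u\<in>I. b u * A a u) / A a a)"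
    have "\<exists>u\<in>insert a I. ?b u \<noteq> 0" using ex insert.hyps by auto
    then have "0 < qform (insert a I) A ?b" by (rule insert.prems(2))
    also have "\<dots> = qform I S b"
      unfolding S_def by (rule qform_extend_schur_complement) (use insert.hyps pos sym in auto)
    finally show ?thesis .
  qed
  obtain r' where r': "r' > 0" "\<And>b. r' * (\<Sum>u\<in>I. (b u)\<^sup>2) \<le> qform I S b"
    using insert.IH[of S, OF S_sym S_pos] by blast
  define D where "D = (\<Sum>u\<in>I. (A a u / A a a)\<^sup>2)"
  have D: "0 \<le> D" by (simp add: D_def sum_nonneg)
  \<comment> \<open>the square pays for \<open>b a\<close> up to \<open>\<beta>\<close>, and the Schur complement pays for \<open>\<beta>\<^sup>2 \<le> s * D\<close> and for \<open>s\<close>\<close>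
  define r where "r = min (A a a / 2) (r' / (2 * D + 1))"
  have r: "0 < r" "2 * r \<le> A a a" "r \<le> r' / (2 * D + 1)"
    using pos r'(1) D by (auto simp: r_def)
  have r3: "r * (2 * D + 1) \<le> r'" using r(3) D by (simp add: pos_le_divide_eq)
  have "r * (\<Sum>u\<in>insert a I. (b u)\<^sup>2) \<le> qform (insert a I) A b" for b
  proof -
    define \<beta> where "\<beta> = (\<Sum>u\<in>I. b u * A a u) / A a a"
    define s where "s = (\<Sum>u\<in>I. (b u)\<^sup>2)"
    have "\<beta> = (\<Sum>u\<in>I. b u * (A a u / A a a))" by (simp add: \<beta>_def sum_divide_distrib)
    then have \<beta>: "\<beta>\<^sup>2 \<le> s * D"
      unfolding s_def D_def using Cauchy_Schwarz_ineq_sum[of b "\<lambda>u. A a u / A a a" I] by simp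
    have "(b a)\<^sup>2 \<le> 2 * (b a + \<beta>)\<^sup>2 + 2 * \<beta>\<^sup>2"
      using sum_squares_bound[of "b a + \<beta>" "-\<beta>"] zero_le_power2[of "b a + 2 * \<beta>"]
      by (simp add: power2_eq_square algebra_simps)
    also have "\<dots> \<le> 2 * (b a + \<beta>)\<^sup>2 + 2 * (s * D)" using \<beta> by simp
    finally have "r * ((b a)\<^sup>2 + s) \<le> r * (2 * (b a + \<beta>)\<^sup>2 + 2 * (s * D) + s)"
      using r(1) by (intro mult_left_mono) auto
    also have "\<dots> = 2 * r * (b a + \<beta>)\<^sup>2 + r * (2 * D + 1) * s"
      by (simp add: algebra_simps)
    also have "\<dots> \<le> A a a * (b a + \<beta>)\<^sup>2 + r' * s"
      using r r3 by (intro add_mono mult_right_mono) (auto simp: s_def sum_nonneg)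
    also have "\<dots> \<le> A a a * (b a + \<beta>)\<^sup>2 + qform I S b"
      using r'(2)[of b] by (simp add: s_def)
    also have "\<dots> = qform (insert a I) A b"
      unfolding S_def \<beta>_def 
      by (rule qform_insert_complete_square[symmetric]) (use insert.hyps pos sym in auto)
    finally show ?thesis using insert.hyps by (simp add: s_def)
  qed
  then show ?case using r(1) by blast
qed

lemma positive_on_dominates_diag:
  assumes "finite I" "positive_on I A"
  shows "\<exists>r>0. psd_on I (\<lambda>u v. A u v - r * of_bool (u = v))"
proof -
  obtain r where r: "r > 0" "\<forall>b. r * (\<Sum>u\<in>I. (b u)\<^sup>2) \<le> qform I A b"
    using strictly_positive_form_lower_bound[of I A] assms unfolding positive_on_def by blast
  have "psd_on I (\<lambda>u v. A u v - r * of_bool (u = v))"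
    using assms r(2) by (auto simp: psd_on_def positive_on_def qform_diff qform_diag)
  then show ?thesis using r(1) by blast
qed

section \<open>Positive definite translation kernels\<close>

lemma positive_definite_kernel_qform:
  assumes "positive_definite_kernel K" "finite I" "inj_on z I" "\<exists>u\<in>I. b u \<noteq> 0"
  shows "0 < qform I (\<lambda>u v. K (z u) (z v)) b"
proof -
  obtain h where h: "bij_betw h {0..<card I} I"
    using ex_bij_betw_nat_finite[OF assms(2)] by blast
  then have h': "bij_betw h {..<card I} I" by (simp add: lessThan_atLeast0)
  have "\<exists>i<card I. b (h i) \<noteq> 0"
  proof -
    obtain u where u: "u \<in> I" "b u \<noteq> 0" using assms(4) by blast
    then have "u \<in> h ` {..<card I}" using bij_betw_imp_surj_on[OF h'] by simp
    then obtain i where "i < card I" "h i = u" by auto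
    then show ?thesis using u by blast
  qed
  moreover have "inj_on (\<lambda>i. z (h i)) {..<card I}"
    using comp_inj_on[OF bij_betw_imp_inj_on[OF h'], of z] assms(3)
    by (simp add: bij_betw_imp_surj_on[OF h'] comp_def)
  ultimately have "0 < (\<Sum>i<card I. \<Sum>j<card I. b (h i) * b (h j) * K (z (h i)) (z (h j)))"
    using assms(1)[unfolded positive_definite_kernel_def, THEN conjunct2, rule_format,
        of "card I" "\<lambda>i. b (h i)" "\<lambda>i. z (h i)"] by simp
  also have "\<dots> = (\<Sum>i<card I. \<Sum>v\<in>I. b (h i) * b v * K (z (h i)) (z v))"
    using sum.reindex_bij_betw[OF h', of "\<lambda>v. b (h i) * b v * K (z (h i)) (z v)" for i] by simp
  also have "\<dots> = qform I (\<lambda>u v. K (z u) (z v)) b"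
    unfolding qform_def
    using sum.reindex_bij_betw[OF h', of "\<lambda>u. \<Sum>v\<in>I. b u * b v * K (z u) (z v)"] by simp
  finally show ?thesis .
qed

text \<open>Repeated points are allowed here: the kernel is pulled back from the set of distinct points.\<close>

lemma positive_definite_kernel_imp_psd_on:
  assumes "positive_definite_kernel K" "finite I"
  shows "psd_on I (\<lambda>u v. K (z u) (z v))"
proof (rule psd_on_pullback)
  show "psd_on (z ` I) K"
    unfolding psd_on_def
  proof (intro conjI allI ballI)
    fix b :: "'a \<Rightarrow> real"
    show "0 \<le> qform (z ` I) K b"
    proof (cases "\<exists>u\<in>z ` I. b u \<noteq> 0")
      case True
      then show ?thesis
        using positive_definite_kernel_qform[OF assms(1), of "z ` I" "\<lambda>u. u" b] assms(2) by simp
    qed (auto simp: qform_def intro!: sum_nonneg)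
  qed (use assms(1) in \<open>auto simp: positive_definite_kernel_def\<close>)
qed (use assms in auto)

lemma translation_kernel_even:
  assumes "positive_definite_kernel (\<lambda>s t. \<Phi> (s - t :: real))"
  shows "\<Phi> (- s) = \<Phi> s"
proof -
  have "\<Phi> (0 - s) = \<Phi> (s - 0)" using assms unfolding positive_definite_kernel_def by blast
  then show ?thesis by simp
qed

lemma translation_kernel_at_0_pos:
  assumes "positive_definite_kernel (\<lambda>s t. \<Phi> (s - t :: real))"
  shows "0 < \<Phi> 0"
  using positive_definite_kernel_qform[OF assms, of "{()}" "\<lambda>_. 0" "\<lambda>_. 1"] by (simp add: qform_def)

lemma translation_kernel_bounded:
  assumes "positive_definite_kernel (\<lambda>s t. \<Phi> (s - t :: real))"
  shows "\<bar>\<Phi> s\<bar> \<le> \<Phi> 0"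
proof -
  have "0 \<le> qform {True, False} (\<lambda>u v. \<Phi> ((if u then s else 0) - (if v then s else 0)))
            (\<lambda>u. if u then c else 1)" for c
    using positive_definite_kernel_imp_psd_on[OF assms, of "{True, False}" "\<lambda>u. if u then s else 0"]
    by (auto simp: psd_on_def)
  from this[of 1] this[of "-1"] show ?thesis
    by (simp add: qform_def translation_kernel_even[OF assms] abs_le_iff)
qed

text \<open>  The form on the points \<open>0\<close>, \<open>s\<close>, \<open>t\<close> with weights \<open>c\<close>, \<open>1\<close>, \<open>-1\<close> is nonnegative; \<open>c\<close> minimises it.
  The inequality turns continuity at \<open>0\<close> into uniform continuity.\<close>

lemma krein_inequality:
  assumes "positive_definite_kernel (\<lambda>s t. \<Phi> (s - t :: real))"
  shows "(\<Phi> s - \<Phi> t)\<^sup>2 \<le> 2 * \<Phi> 0 * (\<Phi> 0 - \<Phi> (s - t))"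
proof -
  note pos = translation_kernel_at_0_pos[OF assms]
  define z where "z = (\<lambda>u::nat. if u = 0 then 0 else if u = 1 then s else t)"
  define D E where "D = \<Phi> s - \<Phi> t" and "E = \<Phi> 0 - \<Phi> (s - t)"
  define c where "c = - D / \<Phi> 0"
  define b where "b = (\<lambda>u::nat. if u = 0 then c else if u = 1 then 1 else -1)"
  have "\<Phi> (t - s) = \<Phi> (s - t)"
    using translation_kernel_even[OF assms, of "s - t"] by simp
  then have "qform {0,1,2} (\<lambda>u v. \<Phi> (z u - z v)) b = c\<^sup>2 * \<Phi> 0 + 2 * c * D + 2 * E"
    by (simp add: D_def E_def qform_def z_def b_def translation_kernel_even[OF assms] algebra_simps power2_eq_square)
  moreover have "0 \<le> qform {0,1,2} (\<lambda>u v. \<Phi> (z u - z v)) b"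
    using positive_definite_kernel_imp_psd_on[OF assms, of "{0,1,2}" z] by (simp add: psd_on_def)
  moreover have "c\<^sup>2 * \<Phi> 0 + 2 * c * D = - (D\<^sup>2 / \<Phi> 0)"
    using pos by (simp add: c_def power2_eq_square)
  ultimately have "D\<^sup>2 / \<Phi> 0 \<le> 2 * E" by linarith
  then show ?thesis using pos by (simp add: D_def[symmetric] E_def[symmetric] field_simps)
qed

text \<open>  If \<open>f\<close> had size \<open>\<epsilon>\<close> at a late point, it would have size \<open>\<epsilon> / 2\<close> on an interval of fixed length
  there, contradicting that the integrals over such late intervals tend to \<open>0\<close>.\<close>

lemma uniformly_continuous_integrable_tendsto_0:
  fixes f :: "real \<Rightarrow> real"
  assumes "uniformly_continuous_on UNIV f" "integrable lborel f"
  shows "(f \<longlongrightarrow> 0) at_top"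
proof (rule tendstoI)
  fix \<epsilon> :: real assume \<epsilon>: "0 < \<epsilon>"
  obtain \<delta> where \<delta>: "0 < \<delta>" "\<And>s t. \<bar>s - t\<bar> < \<delta> \<Longrightarrow> \<bar>f s - f t\<bar> < \<epsilon> / 2"
    using assms(1) \<epsilon> unfolding uniformly_continuous_on_def dist_real_def
    by (metis UNIV_I half_gt_zero)
  define d where "d = \<delta> / 2"
  have d: "0 < d" "d < \<delta>" using \<delta>(1) by (auto simp: d_def)
  have [measurable]: "f \<in> borel_measurable borel"
    using borel_measurable_integrable[OF assms(2)] by simp
  have "((\<lambda>t. LINT s|lborel. indicator {t..t+d} s * \<bar>f s\<bar>) \<longlongrightarrow> (LINT (s::real)|lborel. (0::real))) at_top"
  proof (rule integral_dominated_convergence_at_top[where w = "\<lambda>s. \<bar>f s\<bar>"])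
    show "AE s in lborel. ((\<lambda>t. indicator {t..t+d} s * \<bar>f s\<bar>) \<longlongrightarrow> 0) at_top"
    proof (rule AE_I2)
      fix s :: real
      have "\<forall>\<^sub>F t in at_top. indicator {t..t+d} s * \<bar>f s\<bar> = 0"
        using eventually_gt_at_top[of s] by eventually_elim simp
      then show "((\<lambda>t. indicator {t..t+d} s * \<bar>f s\<bar>) \<longlongrightarrow> 0) at_top"
        by (rule tendsto_eventually)
    qed
  qed (use assms(2) in \<open>auto simp: indicator_def\<close>)
  then have "((\<lambda>t. LINT s|lborel. indicator {t..t+d} s * \<bar>f s\<bar>) \<longlongrightarrow> 0) at_top" by simp
  then have "\<forall>\<^sub>F t in at_top. (LINT s|lborel. indicator {t..t+d} s * \<bar>f s\<bar>) < d * (\<epsilon> / 2)"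
    by (rule order_tendstoD) (use d \<epsilon> in auto)
  then show "\<forall>\<^sub>F t in at_top. dist (f t) 0 < \<epsilon>"
  proof eventually_elim
    case (elim t)
    show ?case
    proof (rule ccontr)
      assume "\<not> dist (f t) 0 < \<epsilon>"
      then have ft: "\<epsilon> \<le> \<bar>f t\<bar>" by simp
      have large: "\<epsilon> / 2 \<le> \<bar>f s\<bar>" if "s \<in> {t..t+d}" for s
      proof -
        have "\<bar>f t - f s\<bar> < \<epsilon> / 2" using that d by (intro \<delta>(2)) auto
        then show ?thesis using ft by linarith
      qed
      have "d * (\<epsilon> / 2) = (LINT s|lborel. indicator {t..t+d} s * (\<epsilon> / 2))"
        using d by simp
      also have "\<dots> \<le> (LINT s|lborel. indicator {t..t+d} s * \<bar>f s\<bar>)"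
      proof (rule integral_mono)
        show "integrable lborel (\<lambda>s. indicator {t..t+d} s * (\<epsilon> / 2))"
          by (intro integrable_mult_left integrable_real_indicator) (use d in auto)
        show "integrable lborel (\<lambda>s. indicator {t..t+d} s * \<bar>f s\<bar>)"
          by (rule Bochner_Integration.integrable_bound[OF integrable_abs[OF assms(2)]])
            (auto simp: indicator_def)
      qed (use large in \<open>auto simp: indicator_def\<close>)
      finally show False using elim by simp
    qed
  qed
qed

lemma translation_kernel_vanishes_at_infinity:
  assumes pd: "positive_definite_kernel (\<lambda>s t. \<Phi> (s - t :: real))"
    and "continuous_on UNIV \<Phi>" "integrable lborel \<Phi>"
  shows "(\<Phi> \<longlongrightarrow> 0) at_top"
proof (rule uniformly_continuous_integrable_tendsto_0[OF _ assms(3)])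
  note pos = translation_kernel_at_0_pos[OF pd]
  show "uniformly_continuous_on UNIV \<Phi>"
    unfolding uniformly_continuous_on_def
  proof (intro allI impI)
    fix \<epsilon> :: real assume "0 < \<epsilon>"
    then have "0 < \<epsilon>\<^sup>2 / (2 * \<Phi> 0)" using pos by simp
    then obtain \<delta> where \<delta>: "0 < \<delta>" "\<And>h. \<bar>h\<bar> < \<delta> \<Longrightarrow> \<bar>\<Phi> h - \<Phi> 0\<bar> < \<epsilon>\<^sup>2 / (2 * \<Phi> 0)"
      using assms(2) unfolding continuous_on_iff dist_real_def by (metis UNIV_I diff_zero)
    have "\<bar>\<Phi> s - \<Phi> t\<bar> < \<epsilon>" if "\<bar>s - t\<bar> < \<delta>" for s t
    proof -
      have "(\<Phi> s - \<Phi> t)\<^sup>2 \<le> 2 * \<Phi> 0 * \<bar>\<Phi> (s - t) - \<Phi> 0\<bar>"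
        using krein_inequality[OF pd, of s t] pos
          mult_left_mono[of "\<Phi> 0 - \<Phi> (s - t)" "\<bar>\<Phi> (s - t) - \<Phi> 0\<bar>" "2 * \<Phi> 0"] by linarith
      also have "\<dots> < \<epsilon>\<^sup>2" using \<delta>(2)[OF that] pos by (simp add: field_simps)
      finally show ?thesis using \<open>0 < \<epsilon>\<close> power_less_imp_less_base[of "\<bar>\<Phi> s - \<Phi> t\<bar>" 2 \<epsilon>] by simp
    qed
    then show "\<exists>d>0. \<forall>x\<in>UNIV. \<forall>x'\<in>UNIV. dist x' x < d \<longrightarrow> dist (\<Phi> x') (\<Phi> x) < \<epsilon>"
      using \<delta>(1) by (auto simp: dist_real_def)
  qed
qed

section \<open>A Turan inequality for exponential sums\<close>

text \<open>  The polynomial is the product of the factors \<open>1 - cnj (w k) * X\<close>; each factor at most doubles the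
  coefficients.\<close>

lemma annihilating_polynomial:
  fixes w :: "'a \<Rightarrow> complex"
  assumes "finite I" "\<And>k. k \<in> I \<Longrightarrow> cmod (w k) = 1"
  shows "\<exists>P. coeff P 0 = 1 \<and> degree P \<le> card I \<and> (\<forall>j. cmod (coeff P j) \<le> 2 ^ card I) \<and>
             (\<forall>k\<in>I. poly P (w k) = 0)"
  using assms
proof (induction I rule: finite_induct)
  case empty
  have "cmod (coeff 1 j) \<le> 1" for j by (simp add: coeff_1)
  then show ?case by (intro exI[of _ 1]) auto
next
  case (insert a I)
  then obtain P where P: "coeff P 0 = 1" "degree P \<le> card I" "\<And>j. cmod (coeff P j) \<le> 2 ^ card I"
      "\<And>k. k \<in> I \<Longrightarrow> poly P (w k) = 0"
    by auto
  have wa: "cmod (w a) = 1" using insert.prems by simp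
  define R where "R = [:1, - cnj (w a):] * P"
  have coeff_R: "coeff R j = coeff P j + (case j of 0 \<Rightarrow> 0 | Suc i \<Rightarrow> - cnj (w a) * coeff P i)" for j
    by (simp add: R_def mult_pCons_left coeff_pCons split: nat.split)
  have "cmod (coeff R j) \<le> 2 ^ card (insert a I)" for j
  proof -
    have "cmod (case j of 0 \<Rightarrow> 0 | Suc i \<Rightarrow> - cnj (w a) * coeff P i) \<le> 2 ^ card I"
      using P(3) wa by (auto simp: norm_mult split: nat.split)
    then show ?thesis
      using norm_triangle_ineq[of "coeff P j" "case j of 0 \<Rightarrow> 0 | Suc i \<Rightarrow> - cnj (w a) * coeff P i"]
        P(3)[of j] insert.hyps by (simp add: coeff_R)
  qed
  moreover have "degree R \<le> card (insert a I)"
    using degree_mult_le[of "[:1, - cnj (w a):]" P] P(2) insert.hyps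
    by (auto simp: R_def split: if_splits)
  moreover have "poly R (w k) = 0" if "k \<in> insert a I" for k
  proof -
    have "w a * cnj (w a) = 1" using wa complex_norm_square[of "w a"] by simp
    then show ?thesis using that P(4) by (auto simp: R_def)
  qed
  ultimately show ?case using P(1) by (intro exI[of _ R]) (simp add: coeff_R)
qed

definition expsum :: "'a set \<Rightarrow> ('a \<Rightarrow> real) \<Rightarrow> ('a \<Rightarrow> real) \<Rightarrow> real \<Rightarrow> complex" where
  "expsum I a z \<xi> = (\<Sum>k\<in>I. complex_of_real (a k) * cis (\<xi> * z k))"

lemma continuous_on_expsum [continuous_intros]: "continuous_on S (expsum I a z)"
  unfolding expsum_def by (intro continuous_intros)

lemma expsum_0: "expsum I a z 0 = complex_of_real (\<Sum>k\<in>I. a k)"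
  by (simp add: expsum_def)

lemma cmod_expsum_square:
  "complex_of_real ((cmod (expsum I a z \<xi>))\<^sup>2)
     = (\<Sum>k\<in>I. \<Sum>l\<in>I. complex_of_real (a k * a l) * cis (\<xi> * (z k - z l)))"
proof -
  have "complex_of_real ((cmod (expsum I a z \<xi>))\<^sup>2) = expsum I a z \<xi> * cnj (expsum I a z \<xi>)"
    by (rule complex_norm_square)
  also have "cnj (expsum I a z \<xi>) = (\<Sum>l\<in>I. complex_of_real (a l) * cis (- (\<xi> * z l)))"
    by (simp add: expsum_def cis_cnj)
  also have "expsum I a z \<xi> * \<dots> = (\<Sum>k\<in>I. \<Sum>l\<in>I. complex_of_real (a k * a l) * (cis (\<xi> * z k) * cis (- (\<xi> * z l))))"
    by (simp add: expsum_def sum_product mult_ac)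
  finally show ?thesis by (simp add: cis_mult right_diff_distrib)
qed

text \<open>  Along the progression \<open>0, h, 2 h, \<dots>\<close> the sum is a combination of powers of the unimodular numbers
  \<open>cis (h * z k)\<close>, so it satisfies the linear recurrence given by their annihilating polynomial. Its
  constant coefficient is \<open>1\<close>, so the recurrence expresses the value at \<open>0\<close> by the following values,
  with coefficients bounded independently of \<open>z\<close> and \<open>h\<close>.\<close>

lemma expsum_progression_bound:
  assumes "finite I"
  shows "(\<Sum>k\<in>I. a k)\<^sup>2 \<le> 4 ^ card I * card I * (\<Sum>j=1..card I. (cmod (expsum I a z (real j * h)))\<^sup>2)"
proof -
  define n where "n = card I"
  define w where "w = (\<lambda>k. cis (h * z k))"
  obtain P where P: "coeff P 0 = 1" "degree P \<le> n" "\<And>j. cmod (coeff P j) \<le> 2 ^ n"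
      "\<And>k. k \<in> I \<Longrightarrow> poly P (w k) = 0"
    using annihilating_polynomial[OF assms, of w] by (auto simp: n_def w_def)
  have power: "w k ^ j = cis (real j * h * z k)" for k j
    by (simp add: w_def Complex.DeMoivre mult_ac)
  have "poly P x = (\<Sum>j\<le>n. coeff P j * x ^ j)" for x
    unfolding poly_altdef using P(2)
    by (intro sum.mono_neutral_left) (auto simp: coeff_eq_0)
  then have zero: "(\<Sum>j\<le>n. coeff P j * w k ^ j) = 0" if "k \<in> I" for k
    using P(4)[OF that] by simp
  have "(\<Sum>j\<le>n. coeff P j * expsum I a z (real j * h))
      = (\<Sum>k\<in>I. complex_of_real (a k) * (\<Sum>j\<le>n. coeff P j * w k ^ j))"
    unfolding expsum_def sum_distrib_left by (subst sum.swap) (simp add: power mult_ac)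
  also have "\<dots> = 0" using zero by simp
  finally have "(\<Sum>j\<le>n. coeff P j * expsum I a z (real j * h)) = 0" .
  then have "expsum I a z 0 = - (\<Sum>j=1..n. coeff P j * expsum I a z (real j * h))"
    unfolding atMost_atLeast0 sum.atLeast_Suc_atMost[OF le0] P(1) by (simp add: eq_neg_iff_add_eq_0)
  then have "cmod (expsum I a z 0) = cmod (\<Sum>j=1..n. coeff P j * expsum I a z (real j * h))"
    by (metis norm_minus_cancel)
  also have "\<dots> \<le> (\<Sum>j=1..n. cmod (coeff P j * expsum I a z (real j * h)))"
    by (rule norm_sum)
  finally have "\<bar>\<Sum>k\<in>I. a k\<bar> \<le> (\<Sum>j=1..n. cmod (coeff P j * expsum I a z (real j * h)))"
    unfolding expsum_0 norm_of_real .
  also have "\<dots> \<le> (\<Sum>j=1..n. 2 ^ n * cmod (expsum I a z (real j * h)))"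
    using P(3) by (intro sum_mono) (simp add: norm_mult mult_right_mono)
  finally have "\<bar>\<Sum>k\<in>I. a k\<bar> \<le> 2 ^ n * (\<Sum>j=1..n. cmod (expsum I a z (real j * h)))"
    by (simp add: sum_distrib_left)
  then have "(\<Sum>k\<in>I. a k)\<^sup>2 \<le> (2 ^ n * (\<Sum>j=1..n. cmod (expsum I a z (real j * h))))\<^sup>2"
    by (metis abs_ge_zero power2_abs power_mono)
  also have "\<dots> = 4 ^ n * (\<Sum>j=1..n. cmod (expsum I a z (real j * h)))\<^sup>2"
    by (simp add: power_mult_distrib power2_eq_square power_mult_distrib[symmetric])
  also have "\<dots> \<le> 4 ^ n * (n * (\<Sum>j=1..n. (cmod (expsum I a z (real j * h)))\<^sup>2))"
    using Cauchy_Schwarz_ineq_sum[of "\<lambda>_. 1" "\<lambda>j. cmod (expsum I a z (real j * h))" "{1..n}"] by simp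
  finally show ?thesis by (simp add: n_def)
qed

lemma integrable_indicator_continuous:
  fixes g :: "real \<Rightarrow> real"
  assumes "continuous_on UNIV g"
  shows "integrable lborel (\<lambda>x. indicator {a..b} x * g x)"
  using borel_integrable_compact[of "{a..b}" g] continuous_on_subset[OF assms]
  by (simp add: indicator_def if_distrib cong: if_cong)

text \<open>  The bound along progressions is averaged over the step \<open>h \<in> [0, 1/n]\<close>; then \<open>j * h\<close> stays in \<open>[0,1]\<close>
  for every \<open>j \<le> n\<close>.\<close>

lemma expsum_turan_mean_square:
  assumes "finite I"
  shows "(\<Sum>k\<in>I. a k)\<^sup>2
           \<le> 4 ^ card I * card I ^ 3 * (LINT \<xi>|lborel. indicator {0..1} \<xi> * (cmod (expsum I a z \<xi>))\<^sup>2)"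
proof (cases "I = {}")
  case False
  define n where "n = card I"
  have n: "0 < n" using False assms by (simp add: n_def card_gt_0_iff)
  define g where "g = (\<lambda>\<xi>. (cmod (expsum I a z \<xi>))\<^sup>2)"
  have g: "continuous_on UNIV g" "\<And>x. 0 \<le> g x"
    unfolding g_def by (intro continuous_intros) auto
  have gj: "continuous_on UNIV (\<lambda>h. g (real j * h))" for j
    by (rule continuous_on_compose2[OF g(1)]) (auto intro!: continuous_intros)
  define G where "G = (LINT \<xi>|lborel. indicator {0..1} \<xi> * g \<xi>)"
  have dilate: "(LINT h|lborel. indicator {0..1/n} h * g (real j * h)) \<le> G" if j: "j \<in> {1..n}" for j
  proof -
    \<comment> \<open>the factor \<open>j \<ge> 1\<close> is the Jacobian of the substitution \<open>\<xi> = j * h\<close>\<close>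
    have "(LINT h|lborel. indicator {0..1/n} h * g (real j * h))
        \<le> real j * (LINT h|lborel. indicator {0..1/n} h * g (real j * h))"
      using j g(2) mult_right_mono[of 1 "real j"] by (simp add: integral_nonneg_AE)
    also have "\<dots> = real j * (LINT h|lborel. indicator {0..j/n} (real j * h) * g (real j * h))"
    proof -
      have "(0 \<le> real j * h) = (0 \<le> h)" "(real j * h \<le> j / n) = (h \<le> 1 / n)" for h
        using j n mult_le_cancel_left_pos[of "real j" h "1 / n"] by (auto simp: zero_le_mult_iff)
      then show ?thesis by (simp add: indicator_def)
    qed
    also have "\<dots> = (LINT \<xi>|lborel. indicator {0..j/n} \<xi> * g \<xi>)"
      using j lborel_integral_real_affine[of "real j" "\<lambda>\<xi>. indicator {0..j/n} \<xi> * g \<xi>" 0] by simp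
    also have "\<dots> \<le> G"
    proof -
      have "real j / n \<le> 1" using j by simp
      then have "x \<le> 1" if "x \<le> real j / n" for x using that by linarith
      then show ?thesis
        unfolding G_def using g
        by (intro integral_mono integrable_indicator_continuous) (auto simp: indicator_def)
    qed
    finally show ?thesis .
  qed
  have "(\<Sum>k\<in>I. a k)\<^sup>2 / n = (LINT h|lborel. indicator {0..1/n} h * (\<Sum>k\<in>I. a k)\<^sup>2)"
    by simp
  also have "\<dots> \<le> (LINT h|lborel. 4 ^ n * n * (\<Sum>j=1..n. indicator {0..1/n} h * g (real j * h)))"
  proof (rule integral_mono)
    fix h :: real
    show "indicator {0..1/n} h * (\<Sum>k\<in>I. a k)\<^sup>2 \<le> 4 ^ n * n * (\<Sum>j=1..n. indicator {0..1/n} h * g (real j * h))"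
      using expsum_progression_bound[OF assms, of a z h]
      by (auto simp: indicator_def n_def g_def)
  next
    show "integrable lborel (\<lambda>h. indicator {0..1/n} h * (\<Sum>k\<in>I. a k)\<^sup>2)"
      by (rule integrable_indicator_continuous) simp
    show "integrable lborel (\<lambda>h. 4 ^ n * n * (\<Sum>j=1..n. indicator {0..1/n} h * g (real j * h)))"
      by (intro integrable_mult_right Bochner_Integration.integrable_sum
          integrable_indicator_continuous[OF gj])
  qed
  also have "\<dots> = 4 ^ n * n * (\<Sum>j=1..n. LINT h|lborel. indicator {0..1/n} h * g (real j * h))"
    by (subst integral_mult_right_zero, subst Bochner_Integration.integral_sum)
      (rule integrable_indicator_continuous[OF gj], rule refl)
  also have "\<dots> \<le> 4 ^ n * n * (\<Sum>j=1..n. G)"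
    using dilate by (intro mult_left_mono sum_mono) auto
  finally have "(\<Sum>k\<in>I. a k)\<^sup>2 / n \<le> 4 ^ n * n * (n * G)" by simp
  then have "(\<Sum>k\<in>I. a k)\<^sup>2 \<le> 4 ^ n * n ^ 3 * G"
    using n by (simp add: pos_divide_le_eq power3_eq_cube mult_ac)
  then show ?thesis by (simp add: G_def g_def n_def)
qed simp

section \<open>A position-independent lower bound for translation kernels\<close>

lemma std_normal_fourier:
  "(LINT v|lborel. complex_of_real (std_normal_density v) * cis (t * v)) = complex_of_real (exp (- t\<^sup>2 / 2))"
proof -
  have "char std_normal_distribution t
      = (LINT v|lborel. std_normal_density v *\<^sub>R iexp (t * v))"
    unfolding char_def by (rule integral_density) auto
  then show ?thesis
    by (simp add: char_std_normal_distribution cis_conv_exp scaleR_conv_of_real)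
qed

text \<open>  Fourier inversion for an integrable function, with a Gaussian factor that makes the double integral
  absolutely convergent: Fubini and the Fourier transform of the Gaussian turn the inversion integral
  into an average of \<open>\<Phi>\<close> around \<open>x\<close> at scale \<open>\<sigma>\<close>.\<close>

lemma
  fixes \<Phi> :: "real \<Rightarrow> real"
  assumes int: "integrable lborel \<Phi>" and \<sigma>: "0 < \<sigma>"
  shows gaussian_regularised_integrable:
      "integrable lborel (\<lambda>\<xi>. fourier_transform \<Phi> \<xi> * complex_of_real (std_normal_density (\<sigma> * \<xi>)) * cis (\<xi> * x))"
    and gaussian_regularised_inversion:
      "(LINT \<xi>|lborel. fourier_transform \<Phi> \<xi> * complex_of_real (std_normal_density (\<sigma> * \<xi>)) * cis (\<xi> * x))
        = complex_of_real (sqrt (2 * pi) * (LINT v|lborel. \<Phi> (x - \<sigma> * v) * std_normal_density v))"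
proof -
  define f where "f = (\<lambda>s \<xi>. complex_of_real (\<Phi> s) * exp (- (\<i> * complex_of_real (\<xi> * s)))
      * complex_of_real (std_normal_density (\<sigma> * \<xi>)) * cis (\<xi> * x))"
  have [measurable]: "\<Phi> \<in> borel_measurable borel"
    using borel_measurable_integrable[OF int] by simp
  have int_n: "integrable lborel (\<lambda>\<xi>. std_normal_density (\<sigma> * \<xi>))"
    using lborel_integrable_real_affine[of std_normal_density \<sigma> 0] \<sigma> by simp
  have norm_f: "cmod (f s \<xi>) = \<bar>\<Phi> s\<bar> * std_normal_density (\<sigma> * \<xi>)" for s \<xi>
    by (simp add: f_def norm_mult)
  have meas [measurable]: "(\<lambda>(s, \<xi>). f s \<xi>) \<in> borel_measurable (lborel \<Otimes>\<^sub>M lborel)"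
    unfolding f_def cis_conv_exp by measurable
  have prod: "integrable (lborel \<Otimes>\<^sub>M lborel) (\<lambda>(s, \<xi>). f s \<xi>)"
  proof (rule lborel_pair.Fubini_integrable[OF meas])
    show "integrable lborel (\<lambda>s. LINT \<xi>|lborel. cmod (case (s, \<xi>) of (s, \<xi>) \<Rightarrow> f s \<xi>))"
      using int by (simp add: norm_f)
    have "integrable lborel (\<lambda>\<xi>. f s \<xi>)" for s
    proof (rule Bochner_Integration.integrable_bound[OF integrable_mult_right[OF int_n, of "\<bar>\<Phi> s\<bar>"]])
      show "(\<lambda>\<xi>. f s \<xi>) \<in> borel_measurable lborel"
        unfolding f_def cis_conv_exp by measurable
    qed (simp add: norm_f)
    then show "AE s in lborel. integrable lborel (\<lambda>\<xi>. case (s, \<xi>) of (s, \<xi>) \<Rightarrow> f s \<xi>)" by simp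
  qed
  have inner_s: "(LINT s|lborel. f s \<xi>)
      = fourier_transform \<Phi> \<xi> * complex_of_real (std_normal_density (\<sigma> * \<xi>)) * cis (\<xi> * x)" for \<xi>
    by (simp add: f_def fourier_transform_def)
  have inner_\<xi>: "(LINT \<xi>|lborel. f s \<xi>)
      = complex_of_real (\<Phi> s * exp (- ((x - s) / \<sigma>)\<^sup>2 / 2) / \<sigma>)" for s
  proof -
    define F where "F = (\<lambda>v. complex_of_real (std_normal_density v) * cis ((x - s) / \<sigma> * v))"
    have "(LINT v|lborel. F v) = \<sigma> *\<^sub>R (LINT \<xi>|lborel. F (\<sigma> * \<xi>))"
      using lborel_integral_real_affine[of \<sigma> F 0] \<sigma> by simp
    moreover have "(LINT v|lborel. F v) = complex_of_real (exp (- ((x - s) / \<sigma>)\<^sup>2 / 2))"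
      unfolding F_def by (rule std_normal_fourier)
    ultimately have F: "(LINT \<xi>|lborel. F (\<sigma> * \<xi>)) = complex_of_real (exp (- ((x - s) / \<sigma>)\<^sup>2 / 2) / \<sigma>)"
      using \<sigma> by (simp add: scaleR_conv_of_real eq_divide_eq mult.commute del: of_real_exp)
    have "f s \<xi> = complex_of_real (\<Phi> s) * F (\<sigma> * \<xi>)" for \<xi>
    proof -
      have "exp (- (\<i> * complex_of_real (\<xi> * s))) * cis (\<xi> * x) = cis ((x - s) / \<sigma> * (\<sigma> * \<xi>))"
      proof -
        have "(x - s) / \<sigma> * (\<sigma> * \<xi>) = \<xi> * x - \<xi> * s" using \<sigma> by (simp add: field_simps)
        then show ?thesis unfolding \<open>(x - s) / \<sigma> * (\<sigma> * \<xi>) = _\<close> cis_conv_exp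
          by (simp add: exp_add[symmetric] algebra_simps)
      qed
      then show ?thesis by (simp add: f_def F_def mult_ac)
    qed
    then show ?thesis by (simp add: F)
  qed
  have "(LINT \<xi>|lborel. fourier_transform \<Phi> \<xi> * complex_of_real (std_normal_density (\<sigma> * \<xi>)) * cis (\<xi> * x))
      = (LINT s|lborel. LINT \<xi>|lborel. f s \<xi>)"
    using lborel_pair.Fubini_integral[OF prod] by (simp add: inner_s)
  also have "\<dots> = complex_of_real (LINT s|lborel. \<Phi> s * exp (- ((x - s) / \<sigma>)\<^sup>2 / 2) / \<sigma>)"
    unfolding inner_\<xi> by (rule integral_complex_of_real)
  also have "(LINT s|lborel. \<Phi> s * exp (- ((x - s) / \<sigma>)\<^sup>2 / 2) / \<sigma>)
      = (LINT v|lborel. \<Phi> (x - \<sigma> * v) * exp (- v\<^sup>2 / 2))"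
    using lborel_integral_real_affine[of "-\<sigma>" "\<lambda>s. \<Phi> s * exp (- ((x - s) / \<sigma>)\<^sup>2 / 2) / \<sigma>" x] \<sigma>
    by simp
  also have "\<dots> = (LINT v|lborel. sqrt (2 * pi) * (\<Phi> (x - \<sigma> * v) * std_normal_density v))"
    by (simp add: std_normal_density_def)
  also have "\<dots> = sqrt (2 * pi) * (LINT v|lborel. \<Phi> (x - \<sigma> * v) * std_normal_density v)"
    by simp
  finally show "(LINT \<xi>|lborel. fourier_transform \<Phi> \<xi> * complex_of_real (std_normal_density (\<sigma> * \<xi>)) * cis (\<xi> * x))
        = complex_of_real (sqrt (2 * pi) * (LINT v|lborel. \<Phi> (x - \<sigma> * v) * std_normal_density v))" .
  show "integrable lborel (\<lambda>\<xi>. fourier_transform \<Phi> \<xi> * complex_of_real (std_normal_density (\<sigma> * \<xi>)) * cis (\<xi> * x))"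
    using lborel_pair.integrable_snd[OF prod] by (simp add: inner_s)
qed

lemma gaussian_average_tendsto:
  assumes "continuous_on UNIV \<Phi>" "\<And>s. \<bar>\<Phi> s\<bar> \<le> B"
  shows "(\<lambda>k. LINT v|lborel. \<Phi> (x - v / real (Suc k)) * std_normal_density v) \<longlonglongrightarrow> \<Phi> x"
proof -
  have [measurable]: "\<Phi> \<in> borel_measurable borel"
    using assms(1) by (rule borel_measurable_continuous_onI)
  have "(\<lambda>k. LINT v|lborel. \<Phi> (x - v / real (Suc k)) * std_normal_density v)
      \<longlonglongrightarrow> (LINT v|lborel. \<Phi> x * std_normal_density v)"
  proof (rule integral_dominated_convergence[where w = "\<lambda>v. B * std_normal_density v"])
    show "AE v in lborel. (\<lambda>k. \<Phi> (x - v / real (Suc k)) * std_normal_density v) \<longlonglongrightarrow> \<Phi> x * std_normal_density v"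
    proof (intro AE_I2 tendsto_mult tendsto_const)
      fix v :: real
      have "(\<lambda>k. x - v * inverse (real (Suc k))) \<longlonglongrightarrow> x - v * 0"
        by (intro tendsto_intros LIMSEQ_inverse_real_of_nat)
      then have "(\<lambda>k. x - v / real (Suc k)) \<longlonglongrightarrow> x" by (simp add: divide_inverse)
      then show "(\<lambda>k. \<Phi> (x - v / real (Suc k))) \<longlonglongrightarrow> \<Phi> x"
        using assms(1) by (intro continuous_on_tendsto_compose[where s = UNIV and f = \<Phi>]) auto
    qed
  qed (use assms(2) in \<open>auto simp: abs_mult intro!: mult_right_mono\<close>)
  then show ?thesis by simp
qed

text \<open>  Regularised at scale \<open>\<sigma>\<close>, the quadratic form equals an integral of \<open>\<bar>A \<xi>\<bar>\<^sup>2\<close> against the Fourier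
  transform of \<open>\<Phi>\<close> and a Gaussian. Both weights are nonnegative everywhere and, for \<open>\<sigma> \<le> 1\<close>, bounded
  below on \<open>[0,1]\<close> by a constant independent of \<open>\<sigma>\<close>, so the bound survives the limit \<open>\<sigma> \<rightarrow> 0\<close>.\<close>

lemma translation_kernel_spectral_bound:
  assumes pd: "positive_definite_kernel (\<lambda>s t. \<Phi> (s - t :: real))"
    and cont: "continuous_on UNIV \<Phi>" and int: "integrable lborel \<Phi>" and "fourier_decay \<Phi>"
  shows "\<exists>c>0. \<forall>(I :: 'a set) z a. finite I \<longrightarrow>
      c * (LINT \<xi>|lborel. indicator {0..1} \<xi> * (cmod (expsum I a z \<xi>))\<^sup>2)
        \<le> qform I (\<lambda>u v. \<Phi> (z u - z v)) a"
proof -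
  obtain C1 C2 \<alpha> :: real where C1: "0 < C1" "1 / 2 < \<alpha>"
    and real: "\<And>\<xi>. fourier_transform \<Phi> \<xi> \<in> \<real>"
    and lower: "\<And>\<xi>. C1 * (1 + \<xi>\<^sup>2) powr (- \<alpha>) \<le> Re (fourier_transform \<Phi> \<xi>)"
    using assms(4) unfolding fourier_decay_def by blast
  define h where "h = (\<lambda>\<xi>. Re (fourier_transform \<Phi> \<xi>))"
  have ft: "fourier_transform \<Phi> \<xi> = complex_of_real (h \<xi>)" for \<xi>
    using real by (simp add: h_def)
  have h_nonneg: "0 \<le> h \<xi>" for \<xi>
    unfolding h_def by (rule order_trans[OF _ lower]) (use C1(1) in simp)
  define c0 where "c0 = C1 * 2 powr (- \<alpha>)"
  have c0: "0 < c0" using C1 by (simp add: c0_def)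
  have h_lower: "c0 \<le> h \<xi>" if "\<xi> \<in> {0..1}" for \<xi>
  proof -
    have "\<xi>\<^sup>2 \<le> 1" using that by (simp add: power_le_one)
    then have "2 powr (- \<alpha>) \<le> (1 + \<xi>\<^sup>2) powr (- \<alpha>)"
      using C1 by (intro powr_mono2') (auto simp: add_pos_nonneg)
    then have "C1 * 2 powr (- \<alpha>) \<le> C1 * (1 + \<xi>\<^sup>2) powr (- \<alpha>)"
      using C1(1) by (intro mult_left_mono) auto
    then show ?thesis unfolding c0_def h_def by (rule order_trans[OF _ lower])
  qed
  define c where "c = c0 * std_normal_density 1 / sqrt (2 * pi)"
  have "0 < c" using c0 by (simp add: c_def normal_density_pos)
  moreover have "c * (LINT \<xi>|lborel. indicator {0..1} \<xi> * (cmod (expsum I a z \<xi>))\<^sup>2)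
        \<le> qform I (\<lambda>u v. \<Phi> (z u - z v)) a" if "finite I" for I :: "'a set" and z a
  proof -
    define g where "g = (\<lambda>\<xi>. (cmod (expsum I a z \<xi>))\<^sup>2)"
    have g: "continuous_on UNIV g" "\<And>\<xi>. 0 \<le> g \<xi>"
      unfolding g_def by (intro continuous_intros) auto
    define q where "q = (\<lambda>k. qform I (\<lambda>u v. LINT w|lborel. \<Phi> ((z u - z v) - w / real (Suc k)) * std_normal_density w) a)"
    have "c * (LINT \<xi>|lborel. indicator {0..1} \<xi> * g \<xi>) \<le> q k" for k
    proof -
      define \<sigma> where "\<sigma> = 1 / real (Suc k)"
      have \<sigma>: "0 < \<sigma>" "\<sigma> \<le> 1" by (auto simp: \<sigma>_def)
      let ?n = "\<lambda>\<xi>. std_normal_density (\<sigma> * \<xi>)"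
      define T where "T = (\<lambda>u v \<xi>. complex_of_real (a u * a v) *
          (fourier_transform \<Phi> \<xi> * complex_of_real (?n \<xi>) * cis (\<xi> * (z u - z v))))"
      have T_int: "integrable lborel (T u v)" for u v
        unfolding T_def by (intro integrable_mult_right gaussian_regularised_integrable int \<sigma>)
      have sum_T: "(\<Sum>u\<in>I. \<Sum>v\<in>I. T u v \<xi>) = complex_of_real (h \<xi> * ?n \<xi> * g \<xi>)" for \<xi>
        unfolding T_def ft g_def of_real_mult cmod_expsum_square
        by (simp add: sum_distrib_left mult_ac)
      have int_hg: "integrable lborel (\<lambda>\<xi>. h \<xi> * ?n \<xi> * g \<xi>)"
      proof -
        have "integrable lborel (\<lambda>\<xi>. \<Sum>u\<in>I. \<Sum>v\<in>I. T u v \<xi>)"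
          by (intro Bochner_Integration.integrable_sum T_int)
        then show ?thesis unfolding sum_T complex_of_real_integrable_eq .
      qed
      have "complex_of_real (LINT \<xi>|lborel. h \<xi> * ?n \<xi> * g \<xi>) = (LINT \<xi>|lborel. (\<Sum>u\<in>I. \<Sum>v\<in>I. T u v \<xi>))"
        unfolding sum_T by (rule integral_complex_of_real[symmetric])
      also have "\<dots> = (\<Sum>u\<in>I. \<Sum>v\<in>I. (LINT \<xi>|lborel. T u v \<xi>))"
        using T_int by simp
      also have "\<dots> = complex_of_real (sqrt (2 * pi) * q k)"
      proof -
        have "(LINT \<xi>|lborel. T u v \<xi>) = complex_of_real (sqrt (2 * pi) *
            (a u * a v * (LINT w|lborel. \<Phi> ((z u - z v) - w / real (Suc k)) * std_normal_density w)))" for u v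
          unfolding T_def integral_mult_right_zero gaussian_regularised_inversion[OF int \<sigma>(1)]
          by (simp add: \<sigma>_def)
        then show ?thesis by (simp add: q_def qform_def sum_distrib_left)
      qed
      finally have eq: "(LINT \<xi>|lborel. h \<xi> * ?n \<xi> * g \<xi>) = sqrt (2 * pi) * q k"
        by (simp only: of_real_eq_iff)
      have "c0 * std_normal_density 1 * (LINT \<xi>|lborel. indicator {0..1} \<xi> * g \<xi>)
          = (LINT \<xi>|lborel. c0 * std_normal_density 1 * (indicator {0..1} \<xi> * g \<xi>))"
        by simp
      also have "\<dots> \<le> (LINT \<xi>|lborel. h \<xi> * ?n \<xi> * g \<xi>)"
      proof (rule integral_mono)
        fix \<xi> :: real
        show "c0 * std_normal_density 1 * (indicator {0..1} \<xi> * g \<xi>) \<le> h \<xi> * ?n \<xi> * g \<xi>"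
        proof (cases "\<xi> \<in> {0..1}")
          case True
          have "(\<sigma> * \<xi>)\<^sup>2 \<le> 1" using True \<sigma> by (intro power_le_one) (auto intro: mult_le_one)
          then have "std_normal_density 1 \<le> ?n \<xi>" by (simp add: std_normal_density_def divide_right_mono)
          then have "c0 * std_normal_density 1 \<le> h \<xi> * ?n \<xi>"
            using h_lower[OF True] c0 h_nonneg by (intro mult_mono) auto
          then show ?thesis using True g(2) by (simp add: mult_right_mono)
        qed (use h_nonneg g(2) in auto)
      qed (use int_hg integrable_indicator_continuous[OF g(1)] in auto)
      finally have "sqrt (2 * pi) * (c * (LINT \<xi>|lborel. indicator {0..1} \<xi> * g \<xi>)) \<le> sqrt (2 * pi) * q k"
        unfolding eq by (simp add: c_def)
      then show ?thesis by (rule mult_left_le_imp_le) simp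
    qed
    moreover have "q \<longlonglongrightarrow> qform I (\<lambda>u v. \<Phi> (z u - z v)) a"
      unfolding q_def qform_def
      by (intro tendsto_sum tendsto_mult tendsto_const
          gaussian_average_tendsto[OF cont translation_kernel_bounded[OF pd]])
    ultimately show ?thesis unfolding g_def by (intro LIMSEQ_le_const[of q]) blast+
  qed
  ultimately show ?thesis by blast
qed

text \<open>  The constant is chosen before the points \<open>z\<close>. With \<open>z u = x u / t\<close> it is therefore uniform in the
  lengthscale \<open>t\<close>, although all points collapse to \<open>0\<close> as \<open>t\<close> grows.\<close>

lemma translation_kernel_dominates_constant:
  assumes "positive_definite_kernel (\<lambda>s t. \<Phi> (s - t :: real))"
    and "continuous_on UNIV \<Phi>" "integrable lborel \<Phi>" "fourier_decay \<Phi>" and I: "finite (I :: 'a set)"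
  shows "\<exists>c>0. \<forall>z a. c * (\<Sum>u\<in>I. a u)\<^sup>2 \<le> qform I (\<lambda>u v. \<Phi> (z u - z v)) a"
proof -
  obtain c where c_pos: "0 < c" and c_bound: "\<forall>(I :: 'a set) z a. finite I \<longrightarrow>
      c * (LINT \<xi>|lborel. indicator {0..1} \<xi> * (cmod (expsum I a z \<xi>))\<^sup>2)
        \<le> qform I (\<lambda>u v. \<Phi> (z u - z v)) a"
    using translation_kernel_spectral_bound[OF assms(1-4)] by blast
  note c = c_pos c_bound[rule_format, OF I]
  define N :: real where "N = 4 ^ card I * card I ^ 3 + 1"
  have N: "0 < N" by (simp add: N_def add_pos_nonneg)
  have "c / N * (\<Sum>u\<in>I. a u)\<^sup>2 \<le> qform I (\<lambda>u v. \<Phi> (z u - z v)) a" for z a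
  proof -
    define G where "G = (LINT \<xi>|lborel. indicator {0..1} \<xi> * (cmod (expsum I a z \<xi>))\<^sup>2)"
    have "0 \<le> G" by (simp add: G_def)
    then have "(\<Sum>u\<in>I. a u)\<^sup>2 \<le> N * G"
      using expsum_turan_mean_square[OF I, of a z] by (simp add: N_def G_def[symmetric] algebra_simps)
    then have "c / N * (\<Sum>u\<in>I. a u)\<^sup>2 \<le> c / N * (N * G)"
      using c(1) N by (intro mult_left_mono) auto
    also have "\<dots> = c * G" using N by simp
    also have "\<dots> \<le> qform I (\<lambda>u v. \<Phi> (z u - z v)) a" using c(2) by (simp add: G_def)
    finally show ?thesis .
  qed
  then show ?thesis using c(1) N by (intro exI[of _ "c / N"]) auto
qed

lemma scaled_kernel_positive_on:
  assumes "positive_definite_kernel (\<lambda>s t. \<Phi> (s - t :: real))" "finite I" "inj_on x I" "0 < t"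
  shows "positive_on I (\<lambda>u v. \<Phi> ((x u - x v) / t))"
  unfolding positive_on_def
proof (intro conjI ballI allI impI)
  fix u v
  have "(x u - x v) / t = - ((x v - x u) / t)" by (simp add: minus_divide_left)
  then show "\<Phi> ((x u - x v) / t) = \<Phi> ((x v - x u) / t)"
    using translation_kernel_even[OF assms(1)] by simp
next
  fix b :: "'a \<Rightarrow> real" assume "\<exists>u\<in>I. b u \<noteq> 0"
  moreover have "inj_on (\<lambda>u. x u / t) I" using assms(3,4) by (auto simp: inj_on_def)
  ultimately show "0 < qform I (\<lambda>u v. \<Phi> ((x u - x v) / t)) b"
    using positive_definite_kernel_qform[OF assms(1,2), of "\<lambda>u. x u / t" b]
    by (simp add: diff_divide_distrib)
qed

lemma scaled_kernel_tendsto_at_top: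
  assumes "continuous_on UNIV \<Phi>"
  shows "((\<lambda>t. \<Phi> (d / t)) \<longlongrightarrow> \<Phi> (0::real)) at_top"
proof -
  have "((\<lambda>t. d / t) \<longlongrightarrow> 0) at_top"
    by (rule tendsto_divide_0[OF tendsto_const filterlim_at_top_imp_at_infinity[OF filterlim_ident]])
  then show ?thesis
    by (intro continuous_on_tendsto_compose[OF assms]) auto
qed

lemma scaled_kernel_tendsto_at_0:
  assumes "positive_definite_kernel (\<lambda>s t. \<Phi> (s - t :: real))"
    and "continuous_on UNIV \<Phi>" "integrable lborel \<Phi>" and "d \<noteq> 0"
  shows "((\<lambda>t. \<Phi> (d / t)) \<longlongrightarrow> 0) (at_right 0)"
proof -
  have "filterlim (\<lambda>t. \<bar>d\<bar> * inverse t) at_top (at_right 0)"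
    by (rule filterlim_tendsto_pos_mult_at_top[OF tendsto_const _ filterlim_inverse_at_top_right])
      (use assms(4) in simp)
  then have "((\<lambda>t. \<Phi> (\<bar>d\<bar> * inverse t)) \<longlongrightarrow> 0) (at_right 0)"
    by (rule filterlim_compose[OF translation_kernel_vanishes_at_infinity[OF assms(1-3)]])
  moreover have "\<Phi> (\<bar>d\<bar> * inverse t) = \<Phi> (d / t)" for t
    using translation_kernel_even[OF assms(1), of "d / t"] by (cases "0 \<le> d") (auto simp: divide_inverse)
  ultimately show ?thesis by simp
qed

section \<open>Positive definite matrices\<close>

lemma tendsto_det:
  fixes M :: "'b \<Rightarrow> real ^ 'n ^ 'n"
  assumes "\<And>k l. ((\<lambda>t. M t $ k $ l) \<longlongrightarrow> M0 $ k $ l) F"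
  shows "((\<lambda>t. det (M t)) \<longlongrightarrow> det M0) F"
  unfolding det_def by (intro tendsto_intros assms)

lemma inner_matrix_vector_qform: "b \<bullet> (M *v b) = qform UNIV (\<lambda>k l. M $ k $ l) (($) b)"
  by (simp add: qform_def inner_vec_def matrix_vector_mult_def sum_distrib_left mult_ac)

lemma definite_imp_invertible:
  fixes M :: "real ^ 'n ^ 'n"
  assumes "\<And>b. b \<noteq> 0 \<Longrightarrow> 0 < b \<bullet> (M *v b)"
  shows "invertible M"
proof -
  have "\<forall>b. M *v b = 0 \<longrightarrow> b = 0" using assms by (metis inner_zero_right less_irrefl)
  then show ?thesis
    using matrix_left_invertible_ker[of M] invertible_left_inverse[of M] by blast
qed

text \<open>  On the segment from the identity matrix to \<open>M\<close> all matrices are positive definite, so the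
  determinant, which starts at \<open>1\<close>, cannot change sign.\<close>

lemma definite_imp_det_pos:
  fixes M :: "real ^ 'n ^ 'n"
  assumes "\<And>b. b \<noteq> 0 \<Longrightarrow> 0 < b \<bullet> (M *v b)"
  shows "0 < det M"
proof (rule ccontr)
  assume neg: "\<not> 0 < det M"
  define N where "N = (\<lambda>s::real. (1 - s) *\<^sub>R mat 1 + s *\<^sub>R M)"
  have "continuous_on {0..1} (\<lambda>s. det (N s))"
    unfolding det_def N_def by (simp, intro continuous_intros)
  moreover have "det (N 1) \<le> 0" "0 \<le> det (N 0)" using neg by (auto simp: N_def)
  ultimately obtain s where s: "0 \<le> s" "s \<le> 1" "det (N s) = 0"
    using IVT2'[of "\<lambda>s. det (N s)" 1 0 0] by auto
  have "0 < b \<bullet> (N s *v b)" if "b \<noteq> 0" for b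
  proof -
    have "b \<bullet> (N s *v b) = (1 - s) * (b \<bullet> b) + s * (b \<bullet> (M *v b))"
      by (simp add: N_def matrix_vector_mult_add_rdistrib scaleR_matrix_vector_assoc[symmetric] inner_add_right)
    moreover have "0 < b \<bullet> b" "0 < b \<bullet> (M *v b)" using that assms by auto
    ultimately show ?thesis
      using s(1,2) by (cases "s = 0") (auto intro: add_nonneg_pos)
  qed
  then have "det (N s) \<noteq> 0" using definite_imp_invertible invertible_det_nz by blast
  then show False using s(3) by simp
qed

lemma matrix_inv_mult_vector:
  fixes M :: "real ^ 'n ^ 'n"
  assumes "invertible M"
  shows "M *v (matrix_inv M *v w) = w"
proof -
  have "M ** matrix_inv M = mat 1 \<and> matrix_inv M ** M = mat 1"
    using assms unfolding matrix_inv_def invertible_def by (rule someI_ex)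
  then show ?thesis by (simp add: matrix_vector_mul_assoc)
qed

text \<open>  Apply the assumption to \<open>b = M\<inverse> w\<close>, for which \<open>b \<bullet> w\<close> and \<open>b \<bullet> M b\<close> both equal the form to be bounded.\<close>

lemma inverse_form_le:
  fixes M :: "real ^ 'n ^ 'n"
  assumes "\<And>b. b \<noteq> 0 \<Longrightarrow> 0 < b \<bullet> (M *v b)"
    and "\<And>b. (b \<bullet> w)\<^sup>2 \<le> C * (b \<bullet> (M *v b))" and "0 \<le> C"
  shows "w \<bullet> (matrix_inv M *v w) \<le> C" 
proof -
  define b where "b = matrix_inv M *v w"
  have Mb: "M *v b = w"
    unfolding b_def by (rule matrix_inv_mult_vector[OF definite_imp_invertible[OF assms(1)]])
  have "(b \<bullet> w)\<^sup>2 \<le> C * (b \<bullet> w)" using assms(2)[of b] by (simp add: Mb)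
  moreover have "0 \<le> b \<bullet> w" using assms(1)[of b] Mb by (cases "b = 0") auto
  ultimately have "b \<bullet> w \<le> C" using assms(3)
    by (cases "b \<bullet> w = 0") (auto simp: power2_eq_square)
  then show ?thesis by (simp add: b_def inner_commute)
qed

lemma inverse_form_nonneg:
  fixes M :: "real ^ 'n ^ 'n"
  assumes "\<And>b. b \<noteq> 0 \<Longrightarrow> 0 < b \<bullet> (M *v b)"
  shows "0 \<le> w \<bullet> (matrix_inv M *v w)"
proof -
  define b where "b = matrix_inv M *v w"
  have Mb: "M *v b = w"
    unfolding b_def by (rule matrix_inv_mult_vector[OF definite_imp_invertible[OF assms]])
  then have "0 \<le> b \<bullet> w" using assms[of b] by (cases "b = 0") auto
  then show ?thesis by (simp add: b_def inner_commute)
qed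

section \<open>Kernel matrices of product kernels on grids\<close>

text \<open>  The index \<open>k\<close> stands for the multi-index \<open>e k\<close>. When \<open>e\<close> enumerates a full grid, this is the Kronecker
  product of the factors.\<close>

definition product_matrix ::
    "('n::finite \<Rightarrow> 'd::finite \<Rightarrow> 'a) \<Rightarrow> ('d \<Rightarrow> 'a \<Rightarrow> 'a \<Rightarrow> real) \<Rightarrow> real ^ 'n ^ 'n" where
  "product_matrix e A = (\<chi> k l. \<Prod>i\<in>UNIV. A i (e k i) (e l i))"

lemma product_matrix_mono:
  assumes "\<And>i. finite (I i)" "\<And>k i. e k i \<in> I i"
    and "\<And>i. psd_on (I i) (A' i)" "\<And>i. psd_on (I i) (\<lambda>u v. A i u v - A' i u v)"
  shows "b \<bullet> (product_matrix e A' *v b) \<le> b \<bullet> (product_matrix e A *v b)"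
proof -
  have "psd_on UNIV (\<lambda>k l. (\<Prod>i\<in>UNIV. A i (e k i) (e l i)) - (\<Prod>i\<in>UNIV. A' i (e k i) (e l i)))"
  proof (rule conjunct2[OF psd_on_prod_mono])
    show "psd_on UNIV (\<lambda>k l. A' i (e k i) (e l i))" for i
      by (rule psd_on_pullback[OF assms(1,3)]) (rule assms(2))
    show "psd_on UNIV (\<lambda>k l. A i (e k i) (e l i) - A' i (e k i) (e l i))" for i
      by (rule psd_on_pullback[OF assms(1,4)]) (rule assms(2))
  qed auto
  then show ?thesis
    by (simp add: inner_matrix_vector_qform product_matrix_def psd_on_def qform_diff)
qed

lemma prod_of_bool: "finite S \<Longrightarrow> (\<Prod>i\<in>S. r i * of_bool (Q i)) = (\<Prod>i\<in>S. r i) * (of_bool (\<forall>i\<in>S. Q i) :: real)"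
  by (induction S rule: finite_induct) auto

text \<open>  Each factor dominates a positive multiple of the identity kernel. As \<open>e\<close> is injective, the product of
  the identity kernels is the identity matrix.\<close>

lemma product_matrix_definite:
  fixes e :: "'n::finite \<Rightarrow> 'd::finite \<Rightarrow> 'a"
  assumes "\<And>i. finite (I i)" "\<And>k i. e k i \<in> I i" "inj e" "\<And>i. positive_on (I i) (A i)" "b \<noteq> 0"
  shows "0 < b \<bullet> (product_matrix e A *v b)"
proof -
  have "\<forall>i. \<exists>r>0. psd_on (I i) (\<lambda>u v. A i u v - r * of_bool (u = v))"
    using positive_on_dominates_diag[OF assms(1,4)] by blast
  from choice[OF this] obtain r
    where r: "\<And>i. 0 < r i" "\<And>i. psd_on (I i) (\<lambda>u v. A i u v - r i * of_bool (u = v))"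
    by blast
  define A' where "A' = (\<lambda>i (u::'a) v. r i * of_bool (u = v))"
  have "product_matrix e A' = (\<chi> k l. (\<Prod>i\<in>UNIV. r i) * of_bool (k = l))"
    using assms(3) by (simp add: product_matrix_def A'_def prod_of_bool fun_eq_iff[symmetric] inj_eq)
  then have "b \<bullet> (product_matrix e A' *v b) = (\<Prod>i\<in>UNIV. r i) * (b \<bullet> b)"
    by (simp add: inner_matrix_vector_qform qform_diag) (simp add: inner_vec_def power2_eq_square)
  moreover have "0 < (\<Prod>i\<in>UNIV. r i) * (b \<bullet> b)" using assms(5) r(1) by (simp add: prod_pos)
  moreover have "b \<bullet> (product_matrix e A' *v b) \<le> b \<bullet> (product_matrix e A *v b)"
    by (rule product_matrix_mono[OF assms(1,2)])
      (use r in \<open>auto simp: A'_def intro!: psd_on_diag assms(1) less_imp_le\<close>)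
  ultimately show ?thesis by linarith
qed

text \<open>  The form on the right is the sum over the classes of \<open>\<tau>\<close> of the squared class sums of \<open>b\<close>, and the
  functional on the left depends on \<open>b\<close> only through these class sums.\<close>

lemma class_constant_cauchy_schwarz:
  fixes w :: "'n::finite \<Rightarrow> real"
  assumes "\<And>k l. \<tau> k = \<tau> l \<Longrightarrow> w k = w l"
  shows "\<exists>C\<ge>0. \<forall>b. (\<Sum>k\<in>UNIV. b k * w k)\<^sup>2 \<le> C * qform UNIV (\<lambda>k l. of_bool (\<tau> k = \<tau> l)) b"
proof -
  define W where "W = (\<lambda>\<rho>. w (inv \<tau> \<rho>))"
  have W: "W (\<tau> k) = w k" for k
    unfolding W_def by (intro assms f_inv_into_f) auto
  have "(\<Sum>k\<in>UNIV. b k * w k)\<^sup>2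
      \<le> (\<Sum>\<rho>\<in>range \<tau>. (W \<rho>)\<^sup>2) * qform UNIV (\<lambda>k l. of_bool (\<tau> k = \<tau> l)) b" for b
  proof -
    define B where "B = (\<lambda>\<rho>. \<Sum>k\<in>UNIV. b k * of_bool (\<tau> k = \<rho>))"
    have pick: "(\<Sum>\<rho>\<in>range \<tau>. of_bool (\<tau> k = \<rho>) * f \<rho>) = f (\<tau> k)" for k and f :: "_ \<Rightarrow> real"
    proof -
      have "(\<Sum>\<rho>\<in>range \<tau>. of_bool (\<tau> k = \<rho>) * f \<rho>) = (\<Sum>\<rho>\<in>range \<tau>. if \<tau> k = \<rho> then f \<rho> else 0)"
        by (intro sum.cong) auto
      then show ?thesis by simp
    qed
    have "(\<Sum>k\<in>UNIV. b k * w k) = (\<Sum>k\<in>UNIV. b k * (\<Sum>\<rho>\<in>range \<tau>. of_bool (\<tau> k = \<rho>) * W \<rho>))"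
      by (simp add: pick W)
    also have "\<dots> = (\<Sum>\<rho>\<in>range \<tau>. W \<rho> * B \<rho>)"
      unfolding B_def sum_distrib_left by (subst sum.swap) (simp add: mult_ac)
    finally have 1: "(\<Sum>k\<in>UNIV. b k * w k) = (\<Sum>\<rho>\<in>range \<tau>. W \<rho> * B \<rho>)" .
    have "qform UNIV (\<lambda>k l. of_bool (\<tau> k = \<tau> l)) b
        = qform UNIV (\<lambda>k l. \<Sum>\<rho>\<in>range \<tau>. of_bool (\<tau> k = \<rho>) * of_bool (\<tau> l = \<rho>)) b"
      by (rule qform_cong) (auto simp: pick eq_commute)
    also have "\<dots> = (\<Sum>\<rho>\<in>range \<tau>. (B \<rho>)\<^sup>2)"
      unfolding qform_sum qform_rank_one B_def ..
    finally show ?thesis unfolding 1 by (simp add: Cauchy_Schwarz_ineq_sum)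
  qed
  moreover have "0 \<le> (\<Sum>\<rho>\<in>range \<tau>. (W \<rho>)\<^sup>2)" by (simp add: sum_nonneg)
  ultimately show ?thesis by blast
qed

text \<open>  The constant \<open>C\<close> works for every \<open>p\<close>-th factor that dominates the constant kernel \<open>c\<close>; this is what
  makes the quadratic term of the likelihood bounded uniformly in the \<open>p\<close>-th lengthscale. The comparison
  matrix pairs two indices exactly when they agree off \<open>p\<close>.\<close>

lemma product_matrix_bounds_invariant_functional:
  fixes e :: "'n::finite \<Rightarrow> 'd::finite \<Rightarrow> 'a" and w :: "real ^ 'n"
  assumes "\<And>i. finite (I i)" "\<And>k i. e k i \<in> I i" "\<And>i. i \<noteq> p \<Longrightarrow> positive_on (I i) (A i)" "0 < c"
    and w: "\<And>k l. (\<forall>i. i \<noteq> p \<longrightarrow> e k i = e l i) \<Longrightarrow> w $ k = w $ l"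
  shows "\<exists>C\<ge>0. \<forall>Ap b. psd_on (I p) (\<lambda>u v. Ap u v - c) \<longrightarrow>
           (b \<bullet> w)\<^sup>2 \<le> C * (b \<bullet> (product_matrix e (A(p := Ap)) *v b))"
proof -
  have "\<forall>i. \<exists>r>0. i \<noteq> p \<longrightarrow> psd_on (I i) (\<lambda>u v. A i u v - r * of_bool (u = v))"
    using positive_on_dominates_diag[OF assms(1,3)] by (metis zero_less_one)
  from choice[OF this] obtain r where r: "\<And>i. 0 < r i"
      "\<And>i. i \<noteq> p \<Longrightarrow> psd_on (I i) (\<lambda>u v. A i u v - r i * of_bool (u = v))"
    by blast
  define A' where "A' = (\<lambda>i (u::'a) v. r i * of_bool (u = v)) (p := \<lambda>u v. c)"
  define \<tau> where "\<tau> = (\<lambda>k. restrict (e k) (- {p}))"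
  have \<tau>: "\<tau> k = \<tau> l \<longleftrightarrow> (\<forall>i. i \<noteq> p \<longrightarrow> e k i = e l i)" for k l
    by (auto simp: \<tau>_def restrict_def fun_eq_iff)
  define R where "R = c * (\<Prod>i\<in>UNIV - {p}. r i)"
  have R: "0 < R" using assms(4) r(1) by (simp add: R_def prod_pos)
  have "(\<Prod>i\<in>UNIV. A' i (e k i) (e l i)) = R * of_bool (\<tau> k = \<tau> l)" for k l
  proof -
    have "(\<Prod>i\<in>UNIV. A' i (e k i) (e l i))
        = c * (\<Prod>i\<in>UNIV - {p}. r i * of_bool (e k i = e l i))"
      by (subst prod.remove[of _ p]) (auto simp: A'_def intro!: prod.cong)
    moreover have "(\<forall>i\<in>UNIV - {p}. e k i = e l i) \<longleftrightarrow> \<tau> k = \<tau> l" by (auto simp: \<tau>)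
    ultimately show ?thesis by (simp only: prod_of_bool finite R_def mult.assoc)
  qed
  then have A': "b \<bullet> (product_matrix e A' *v b) = R * qform UNIV (\<lambda>k l. of_bool (\<tau> k = \<tau> l)) (($) b)" for b
    by (simp add: inner_matrix_vector_qform product_matrix_def qform_cmult)
  obtain C where C: "0 \<le> C" "\<And>b. (\<Sum>k\<in>UNIV. b k * w $ k)\<^sup>2 \<le> C * qform UNIV (\<lambda>k l. of_bool (\<tau> k = \<tau> l)) b"
    using class_constant_cauchy_schwarz[of \<tau> "($) w"] w \<tau> by blast
  have "(b \<bullet> w)\<^sup>2 \<le> C / R * (b \<bullet> (product_matrix e (A(p := Ap)) *v b))"
    if Ap: "psd_on (I p) (\<lambda>u v. Ap u v - c)" for Ap b
  proof -
    have le: "b \<bullet> (product_matrix e A' *v b) \<le> b \<bullet> (product_matrix e (A(p := Ap)) *v b)"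
    proof (rule product_matrix_mono[OF assms(1,2)])
      show "psd_on (I i) (A' i)" for i
        using assms(4) r(1)[of i] by (auto simp: A'_def intro!: psd_on_diag psd_on_const assms(1))
      show "psd_on (I i) (\<lambda>u v. (A(p := Ap)) i u v - A' i u v)" for i
        using Ap r(2)[of i] by (auto simp: A'_def)
    qed
    have "(b \<bullet> w)\<^sup>2 \<le> C * qform UNIV (\<lambda>k l. of_bool (\<tau> k = \<tau> l)) (($) b)"
      using C(2)[of "($) b"] by (simp add: inner_vec_def)
    also have "\<dots> = C / R * (b \<bullet> (product_matrix e A' *v b))" using R by (simp add: A')
    also have "\<dots> \<le> C / R * (b \<bullet> (product_matrix e (A(p := Ap)) *v b))"
      using le C(1) R by (intro mult_left_mono) auto
    finally show ?thesis .
  qed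
  then show ?thesis using C(1) R by (intro exI[of _ "C / R"]) auto
qed

lemma tendsto_det_product_matrix:
  assumes "\<And>k i. e k i \<in> I i"
    and "\<And>i u v. u \<in> I i \<Longrightarrow> v \<in> I i \<Longrightarrow> ((\<lambda>t. A t i u v) \<longlongrightarrow> A0 i u v) F"
  shows "((\<lambda>t. det (product_matrix e (A t))) \<longlongrightarrow> det (product_matrix e A0)) F"
  by (rule tendsto_det) (simp add: product_matrix_def, intro tendsto_prod assms)

text \<open>  The multi-indices \<open>(1, \<dots>, 1)\<close> and the one with \<open>2\<close> at position \<open>p\<close> give equal rows.\<close>

lemma det_product_matrix_constant_factor:
  fixes e :: "'n::finite \<Rightarrow> 'd::finite \<Rightarrow> nat"
  assumes "2 \<le> n p" "\<And>i. 1 \<le> n i" "bij_betw e UNIV (multi_indices n)" "\<And>u v. A p u v = c"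
  shows "det (product_matrix e A) = 0"
proof -
  have "(\<lambda>_. 1) \<in> multi_indices n" "(\<lambda>_. 1)(p := 2) \<in> multi_indices n"
    using assms(1,2) by (auto simp: multi_indices_def)
  then obtain k l where kl: "e k = (\<lambda>_. 1)" "e l = (\<lambda>_. 1)(p := 2)"
    using bij_betw_imp_surj_on[OF assms(3)] by (metis imageE)
  have "k \<noteq> l" using kl by (metis fun_upd_same numeral_eq_one_iff semiring_norm(85))
  moreover have "row k (product_matrix e A) = row l (product_matrix e A)"
  proof -
    have "(\<Prod>i\<in>UNIV. A i (e k i) (e j i)) = (\<Prod>i\<in>UNIV. A i (e l i) (e j i))" for j
      by (rule prod.cong) (auto simp: kl assms(4))
    then show ?thesis by (simp add: row_def product_matrix_def)
  qed
  ultimately show ?thesis by (rule det_identical_rows)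
qed

section \<open>Lengthscale estimates at infinity\<close>

lemma positive_on_half_line_bounded_below:
  fixes g :: "real \<Rightarrow> real"
  assumes "continuous_on {0<..} g" "(g \<longlongrightarrow> g0) (at_right 0)" "0 < g0" "\<And>t. 0 < t \<Longrightarrow> 0 < g t"
  shows "\<exists>\<delta>>0. \<forall>t. 0 < t \<and> t \<le> T \<longrightarrow> \<delta> \<le> g t"
proof -
  have "\<forall>\<^sub>F t in at_right 0. g0 / 2 < g t" using assms(2,3) by (intro order_tendstoD) auto
  then obtain a where a: "0 < a" "\<And>t. 0 < t \<Longrightarrow> t < a \<Longrightarrow> g0 / 2 < g t"
    unfolding eventually_at_right_field by blast
  show ?thesis
  proof (cases "a \<le> T")
    case True
    have "continuous_on {a..T} g" using a(1) by (intro continuous_on_subset[OF assms(1)]) auto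
    then obtain t0 where t0: "t0 \<in> {a..T}" "\<And>t. t \<in> {a..T} \<Longrightarrow> g t0 \<le> g t"
      using continuous_attains_inf[of "{a..T}" g] True by auto
    have "min (g0 / 2) (g t0) \<le> g t" if "0 < t" "t \<le> T" for t
      using a(2)[of t] t0(2)[of t] that by (cases "t < a") auto
    moreover have "0 < min (g0 / 2) (g t0)" using assms(3,4) a(1) t0(1) by auto
    ultimately show ?thesis by blast
  next
    case False
    then show ?thesis using a assms(3) by (intro exI[of _ "g0 / 2"]) (auto intro: less_imp_le)
  qed
qed

text \<open>  The infimum is \<open>-\<infinity>\<close>, so along a minimising sequence the values drop below the lower bound that holds on
  \<open>(0, T]\<close>, and the sequence leaves this interval.\<close>

lemma argmin_is_infinityI:
  assumes "filterlim f at_bot at_top" "\<And>T. \<exists>B. \<forall>t. 0 < t \<and> t \<le> T \<longrightarrow> B \<le> f t"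
  shows "argmin_is_infinity f"
  unfolding argmin_is_infinity_def
proof (intro allI impI)
  fix s :: "nat \<Rightarrow> real"
  assume s: "\<forall>k. 0 < s k" and lim: "(\<lambda>k. ereal (f (s k))) \<longlonglongrightarrow> (INF t\<in>{0<..}. ereal (f t))"
  have "(INF t\<in>{0<..}. ereal (f t)) \<le> ereal B" for B
  proof -
    have "\<forall>\<^sub>F t in at_top. f t \<le> B \<and> 0 < t"
      using assms(1) eventually_gt_at_top[of 0] unfolding filterlim_at_bot by (auto intro: eventually_conj)
    then obtain t where "f t \<le> B" "0 < t" using eventually_happens by fastforce
    then show ?thesis by (intro INF_lower2[of t]) auto
  qed
  then have inf: "(INF t\<in>{0<..}. ereal (f t)) = - \<infinity>" by (rule ereal_bot)
  show "filterlim s at_top sequentially"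
    unfolding filterlim_at_top_dense
  proof
    fix T
    obtain B where B: "\<And>t. 0 < t \<Longrightarrow> t \<le> T \<Longrightarrow> B \<le> f t" using assms(2) by blast
    have "\<forall>\<^sub>F k in sequentially. ereal (f (s k)) < ereal B"
      using lim unfolding inf by (rule order_tendstoD) simp
    then show "\<forall>\<^sub>F k in sequentially. T < s k"
      by eventually_elim (use B s in \<open>force simp: not_le[symmetric]\<close>)
  qed
qed

theorem theorem5p3:
  fixes \<Phi> :: "'d::finite \<Rightarrow> real \<Rightarrow> real"
    and n :: "'d \<Rightarrow> nat"
    and x :: "'d \<Rightarrow> nat \<Rightarrow> real"
    and m :: "real ^ 'd \<Rightarrow> real"
    and y :: "('d \<Rightarrow> nat) \<Rightarrow> real"
    and e :: "'n::finite \<Rightarrow> 'd \<Rightarrow> nat"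
    and lam :: "'d \<Rightarrow> real"
    and p :: 'd
  defines "L \<equiv> \<lambda>t. likelihood_objective (product_kernel \<Phi> (lam(p := t))) m
                   (\<lambda>k. grid_point x (e k)) (\<chi> k. y (e k))"
  assumes "\<And>i. positive_definite_kernel (\<lambda>s t. \<Phi> i (s - t))"
    and "\<And>i. continuous_on UNIV (\<Phi> i)"
    and "\<And>i. integrable lborel (\<Phi> i)"
    and "\<And>i. fourier_decay (\<Phi> i)"
    and "\<And>i. 1 \<le> n i"
    and "2 \<le> n p"
    and "\<And>i. inj_on (x i) {1..n i}"
    and "bij_betw e UNIV (multi_indices n)"
    and "\<And>i. i \<noteq> p \<Longrightarrow> 0 < lam i"
    and "m_constant_along p n x m y"
  shows "filterlim L at_bot at_top \<and> argmin_is_infinity L"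
proof -
  define I where "I = (\<lambda>i. {1..n i})"
  define A where "A = (\<lambda>i u v. \<Phi> i ((x i u - x i v) / lam i))"
  define P where "P = (\<lambda>t u v. \<Phi> p ((x p u - x p v) / t))"
  define M where "M = (\<lambda>t. product_matrix e (A(p := P t)))"
  define w :: "real ^ 'n" where "w = (\<chi> k. y (e k) - m (grid_point x (e k)))"
  define q where "q = (\<lambda>t. w \<bullet> (matrix_inv (M t) *v w))"
  have fin: "finite (I i)" for i by (simp add: I_def)
  have e_in: "e k i \<in> I i" for k i
    using bij_betwE[OF assms(9)] by (auto simp: I_def multi_indices_def)
  have inj_e: "inj e" using assms(9) by (rule bij_betw_imp_inj_on)
  have A_pos: "positive_on (I i) (A i)" if "i \<noteq> p" for i
    unfolding A_def I_def by (intro scaled_kernel_positive_on assms that) auto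
  have P_pos: "positive_on (I p) (P t)" if "0 < t" for t
    unfolding P_def I_def by (intro scaled_kernel_positive_on assms that) auto

  have M: "kernel_matrix (product_kernel \<Phi> (lam(p := t))) (\<lambda>k. grid_point x (e k)) = M t" for t
    unfolding M_def kernel_matrix_def product_kernel_def product_matrix_def grid_point_def
    by (auto simp: vec_eq_iff A_def P_def intro!: prod.cong)
  have "(\<chi> k. y (e k)) - (\<chi> k. m (grid_point x (e k))) = w"
    by (simp add: w_def vec_eq_iff)
  then have L: "L t = q t + ln (det (M t))" for t
    by (simp add: L_def likelihood_objective_def M q_def Let_def)

  \<comment> \<open>stated for an arbitrary \<open>p\<close>-th factor, since the limit factor at \<open>t = 0\<close> is needed as well\<close>
  have definite: "0 < b \<bullet> (product_matrix e (A(p := B)) *v b)"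
    if "positive_on (I p) B" "b \<noteq> 0" for B b
    by (rule product_matrix_definite[OF fin e_in inj_e _ that(2)]) (use that(1) A_pos in auto)
  have M_definite: "0 < b \<bullet> (M t *v b)" if "0 < t" "b \<noteq> 0" for t b
    unfolding M_def by (rule definite[OF P_pos[OF that(1)] that(2)])
  have det_pos: "0 < det (M t)" if "0 < t" for t
    by (rule definite_imp_det_pos) (rule M_definite[OF that])
  have det_tendsto: "((\<lambda>t. det (M t)) \<longlongrightarrow> det (product_matrix e (A(p := B)))) F"
    if "\<And>u v. u \<in> I p \<Longrightarrow> v \<in> I p \<Longrightarrow> ((\<lambda>t. P t u v) \<longlongrightarrow> B u v) F" for B F
    unfolding M_def by (rule tendsto_det_product_matrix[OF e_in]) (use that in auto)

  \<comment> \<open>one constant \<open>c\<close> for all \<open>t\<close>\<close>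
  obtain c where c: "0 < c"
      "\<And>z a. c * (\<Sum>u\<in>I p. a u)\<^sup>2 \<le> qform (I p) (\<lambda>u v. \<Phi> p (z u - z v)) a"
    using translation_kernel_dominates_constant[OF assms(2-5) fin] by blast
  have P_dom: "psd_on (I p) (\<lambda>u v. P t u v - c)" if "0 < t" for t
  proof -
    have "c * (\<Sum>u\<in>I p. b u)\<^sup>2 \<le> qform (I p) (P t) b" for b
      using c(2)[where z = "\<lambda>u. x p u / t" and a = b] by (simp add: P_def diff_divide_distrib)
    then show ?thesis
      using P_pos[OF that] by (auto simp: psd_on_def positive_on_def qform_diff qform_const)
  qed
  have w_const: "w $ k = w $ l" if "\<forall>i. i \<noteq> p \<longrightarrow> e k i = e l i" for k l
    using assms(11) that bij_betwE[OF assms(9)] unfolding m_constant_along_def w_def by simp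
  have "\<exists>C\<ge>0. \<forall>Ap b. psd_on (I p) (\<lambda>u v. Ap u v - c) \<longrightarrow>
      (b \<bullet> w)\<^sup>2 \<le> C * (b \<bullet> (product_matrix e (A(p := Ap)) *v b))"
    by (rule product_matrix_bounds_invariant_functional[where I = I])
      (use fin e_in A_pos c(1) w_const in auto)
  then obtain C where C_nonneg: "0 \<le> C" and C_bound: "\<forall>Ap b. psd_on (I p) (\<lambda>u v. Ap u v - c) \<longrightarrow>
      (b \<bullet> w)\<^sup>2 \<le> C * (b \<bullet> (product_matrix e (A(p := Ap)) *v b))"
    by (elim exE conjE)
  note C = C_nonneg C_bound[rule_format]
  have q_le: "q t \<le> C" if "0 < t" for t
    unfolding q_def
    by (rule inverse_form_le[OF M_definite[OF that] _ C(1)])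
      (auto simp: M_def intro: C(2)[OF P_dom[OF that]])
  have q_nonneg: "0 \<le> q t" if "0 < t" for t
    unfolding q_def by (rule inverse_form_nonneg) (rule M_definite[OF that])

  have "((\<lambda>t. det (M t)) \<longlongrightarrow> det (product_matrix e (A(p := \<lambda>u v. \<Phi> p 0)))) at_top"
    by (rule det_tendsto) (simp add: P_def scaled_kernel_tendsto_at_top[OF assms(3)])
  moreover have "det (product_matrix e (A(p := \<lambda>u v. \<Phi> p 0))) = 0"
    by (rule det_product_matrix_constant_factor[OF assms(7,6,9)]) simp
  ultimately have "((\<lambda>t. det (M t)) \<longlongrightarrow> 0) at_top" by simp
  then have "filterlim (\<lambda>t. det (M t)) (at_right 0) at_top"
    by (rule tendsto_imp_filterlim_at_right)
      (use eventually_gt_at_top[of 0] in eventually_elim, rule det_pos)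
  then have ln_det: "filterlim (\<lambda>t. ln (det (M t))) at_bot at_top"
    by (rule filterlim_compose[OF ln_at_0])
  have L_at_bot: "filterlim L at_bot at_top"
    unfolding filterlim_at_bot
  proof
    fix Z
    have "\<forall>\<^sub>F t in at_top. ln (det (M t)) \<le> Z - C" using ln_det unfolding filterlim_at_bot by blast
    then show "\<forall>\<^sub>F t in at_top. L t \<le> Z"
      using eventually_gt_at_top[of 0] by eventually_elim (use q_le in \<open>force simp: L\<close>)
  qed

  \<comment> \<open>the limit of the \<open>p\<close>-th factor as \<open>t\<close> tends to \<open>0\<close>; the term \<open>P 0\<close> itself is the constant \<open>\<Phi> p 0\<close>, as \<open>x / 0 = 0\<close>\<close>
  define D where "D = (\<lambda>(u::nat) v. \<Phi> p 0 * of_bool (u = v))"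
  have D_pos: "positive_on (I p) D"
    unfolding positive_on_def D_def
  proof (intro conjI allI impI)
    fix b :: "nat \<Rightarrow> real" assume "\<exists>u\<in>I p. b u \<noteq> 0"
    then have "0 < (\<Sum>u\<in>I p. (b u)\<^sup>2)"
      by (metis fin sum_pos2 zero_le_power2 zero_less_power2)
    then show "0 < qform (I p) (\<lambda>u v. \<Phi> p 0 * of_bool (u = v)) b"
      using translation_kernel_at_0_pos[OF assms(2)] by (simp add: qform_diag[OF fin])
  qed auto
  have det_D_pos: "0 < det (product_matrix e (A(p := D)))"
    by (rule definite_imp_det_pos) (rule definite[OF D_pos])
  have det_at_0: "((\<lambda>t. det (M t)) \<longlongrightarrow> det (product_matrix e (A(p := D)))) (at_right 0)"
  proof (rule det_tendsto)
    fix u v assume uv: "u \<in> I p" "v \<in> I p"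
    show "((\<lambda>t. P t u v) \<longlongrightarrow> D u v) (at_right 0)"
    proof (cases "u = v")
      case False
      then have "x p u - x p v \<noteq> 0"
        using inj_on_contraD[OF assms(8)[of p] False] uv by (simp add: I_def)
      then show ?thesis
        using scaled_kernel_tendsto_at_0[OF assms(2-4)] False by (simp add: P_def D_def)
    qed (simp add: P_def D_def)
  qed
  have det_cont: "continuous_on {0<..} (\<lambda>t. det (M t))"
    unfolding continuous_on_def
  proof
    fix t :: real assume "t \<in> {0<..}"
    then have "((\<lambda>s. P s u v) \<longlongrightarrow> P t u v) (at t within {0<..})" for u v
      unfolding P_def
      by (intro continuous_on_tendsto_compose[OF assms(3)] tendsto_intros) auto
    then show "((\<lambda>t. det (M t)) \<longlongrightarrow> det (M t)) (at t within {0<..})"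
      using det_tendsto[of "P t"] by (simp add: M_def)
  qed
  note det_bound = positive_on_half_line_bounded_below[OF det_cont det_at_0 det_D_pos det_pos]
  have "\<exists>B. \<forall>t. 0 < t \<and> t \<le> T \<longrightarrow> B \<le> L t" for T
  proof -
    obtain \<delta> where \<delta>: "0 < \<delta>" "\<And>t. 0 < t \<Longrightarrow> t \<le> T \<Longrightarrow> \<delta> \<le> det (M t)"
      using det_bound[of T] by blast
    have "ln \<delta> \<le> L t" if "0 < t" "t \<le> T" for t
      using \<delta>(1) \<delta>(2)[OF that] q_nonneg[OF that(1)] det_pos[OF that(1)] by (simp add: L add_increasing)
    then show ?thesis by blast
  qed
  then show ?thesis using L_at_bot argmin_is_infinityI[OF L_at_bot] by blast
qed

end
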